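(* An atomless MV-chain is pseudo-simple if, and only if, it is regular.
   Context: An MV-chain is an MV-algebra $(A,\oplus,\neg,0)$ (with $1=\neg0$) whose natural order $x\le y\Leftrightarrow\exists z\,x\oplus z=y$ is linear. Write $n.x=x\oplus\cdots\oplus x$ ($n$ times). An atom is an element $x>0$ such that $y\le x$ implies $y=0$ or $y=x$; $A$ is atomless if it has no atom. $A$ is regular if for every integer $n\ge2$ and all $0<x_1<\cdots<x_n$ in $A$ there is $x\in A$ with $x_1\le n.x\le x_n$ and $0<x<2.x<\cdots<(n-1).x<n.x$. An MV-chain is simple if it embeds in $[0,1]_{\mathbb{R}}$ (with $x\oplus y=\min(x+y,1)$, $\neg x=1-x$). $A$ is pseudo-simple if it belongs to the elementary class generated by the simple MV-chains, i.e. it satisfies every first-order sentence (language $(0,\oplus,\neg)$) true in all simple MV-chains.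
   Formalization: The MV-chain is assumed nontrivial (0 ≠ 1): the one-element MV-algebra is vacuously atomless and regular, but it is not pseudo-simple, since 0 ≠ ¬0 holds in every simple MV-chain. *)

theory Defs
  imports Complex_Main "HOL-Algebra.Congruence"
begin

section \<open>MV-algebras and MV-chains\<close>

record 'a mv_struct = "'a partial_object" +
  mv_plus :: "'a \<Rightarrow> 'a \<Rightarrow> 'a"  (infixl "\<oplus>\<index>" 65)
  mv_neg  :: "'a \<Rightarrow> 'a"  ("\<sim>\<index> _" [81] 80)
  mv_zero :: 'a  ("\<zero>\<index>")

definition mv_one :: "('a, 'b) mv_struct_scheme \<Rightarrow> 'a"  ("\<one>\<index>")
  where "\<one>\<^bsub>A\<^esub> = \<sim>\<^bsub>A\<^esub> \<zero>\<^bsub>A\<^esub>"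

locale mv_algebra =
  fixes A :: "('a, 'b) mv_struct_scheme" (structure)
  assumes zero_closed: "\<zero> \<in> carrier A"
    and plus_closed: "\<lbrakk>x \<in> carrier A; y \<in> carrier A\<rbrakk> \<Longrightarrow> x \<oplus> y \<in> carrier A"
    and neg_closed: "x \<in> carrier A \<Longrightarrow> \<sim> x \<in> carrier A"
    and plus_assoc: "\<lbrakk>x \<in> carrier A; y \<in> carrier A; z \<in> carrier A\<rbrakk>
      \<Longrightarrow> (x \<oplus> y) \<oplus> z = x \<oplus> (y \<oplus> z)"
    and plus_comm: "\<lbrakk>x \<in> carrier A; y \<in> carrier A\<rbrakk> \<Longrightarrow> x \<oplus> y = y \<oplus> x"
    and plus_zero: "x \<in> carrier A \<Longrightarrow> x \<oplus> \<zero> = x"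
    and neg_neg: "x \<in> carrier A \<Longrightarrow> \<sim> (\<sim> x) = x"
    and plus_one: "x \<in> carrier A \<Longrightarrow> x \<oplus> \<one> = \<one>"
    and lukasiewicz: "\<lbrakk>x \<in> carrier A; y \<in> carrier A\<rbrakk>
      \<Longrightarrow> \<sim> (\<sim> x \<oplus> y) \<oplus> y = \<sim> (\<sim> y \<oplus> x) \<oplus> x"

definition mv_le :: "('a, 'b) mv_struct_scheme \<Rightarrow> 'a \<Rightarrow> 'a \<Rightarrow> bool"
  where "mv_le A x y \<longleftrightarrow> (\<exists>z\<in>carrier A. x \<oplus>\<^bsub>A\<^esub> z = y)"

definition mv_less :: "('a, 'b) mv_struct_scheme \<Rightarrow> 'a \<Rightarrow> 'a \<Rightarrow> bool"
  where "mv_less A x y \<longleftrightarrow> mv_le A x y \<and> x \<noteq> y"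

text \<open>The one-element algebra counts as an MV-chain here.\<close>

locale mv_chain = mv_algebra +
  assumes linear: "\<lbrakk>x \<in> carrier A; y \<in> carrier A\<rbrakk> \<Longrightarrow> mv_le A x y \<or> mv_le A y x"

primrec mv_nmult :: "('a, 'b) mv_struct_scheme \<Rightarrow> nat \<Rightarrow> 'a \<Rightarrow> 'a"
  where
    "mv_nmult A 0 x = \<zero>\<^bsub>A\<^esub>"
  | "mv_nmult A (Suc n) x = mv_nmult A n x \<oplus>\<^bsub>A\<^esub> x"

definition mv_atom :: "('a, 'b) mv_struct_scheme \<Rightarrow> 'a \<Rightarrow> bool"
  where "mv_atom A x \<longleftrightarrow> x \<in> carrier A \<and> mv_less A \<zero>\<^bsub>A\<^esub> x \<and>
    (\<forall>y\<in>carrier A. mv_le A y x \<longrightarrow> y = \<zero>\<^bsub>A\<^esub> \<or> y = x)"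

definition mv_atomless :: "('a, 'b) mv_struct_scheme \<Rightarrow> bool"
  where "mv_atomless A \<longleftrightarrow> \<not> (\<exists>x. mv_atom A x)"

text \<open>The chain \<open>0 < x\<^sub>1 < \<dots> < x\<^sub>n\<close> is the restriction of \<open>x\<close> to \<open>{1..n}\<close>; in the
  conclusion, \<open>k = 0\<close> is the inequality \<open>0 < y\<close>.\<close>

definition mv_regular :: "('a, 'b) mv_struct_scheme \<Rightarrow> bool"
  where "mv_regular A \<longleftrightarrow>
    (\<forall>n\<ge>2. \<forall>x :: nat \<Rightarrow> 'a.
      (\<forall>i\<in>{1..n}. x i \<in> carrier A) \<and> mv_less A \<zero>\<^bsub>A\<^esub> (x 1) \<and>
      (\<forall>i\<in>{1..<n}. mv_less A (x i) (x (Suc i))) \<longrightarrow>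
      (\<exists>y\<in>carrier A. mv_le A (x 1) (mv_nmult A n y) \<and> mv_le A (mv_nmult A n y) (x n) \<and>
        (\<forall>k<n. mv_less A (mv_nmult A k y) (mv_nmult A (Suc k) y))))"


section \<open>Simple MV-chains\<close>

definition mv_embedding ::
    "('a, 'c) mv_struct_scheme \<Rightarrow> ('b, 'd) mv_struct_scheme \<Rightarrow> ('a \<Rightarrow> 'b) \<Rightarrow> bool"
  where "mv_embedding A B f \<longleftrightarrow>
    f ` carrier A \<subseteq> carrier B \<and> inj_on f (carrier A) \<and> f \<zero>\<^bsub>A\<^esub> = \<zero>\<^bsub>B\<^esub> \<and>
    (\<forall>x\<in>carrier A. f (\<sim>\<^bsub>A\<^esub> x) = \<sim>\<^bsub>B\<^esub> (f x)) \<and>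
    (\<forall>x\<in>carrier A. \<forall>y\<in>carrier A. f (x \<oplus>\<^bsub>A\<^esub> y) = f x \<oplus>\<^bsub>B\<^esub> f y)"

definition mv_unit_interval :: "real mv_struct"
  where "mv_unit_interval =
    \<lparr>carrier = {0..1}, mv_plus = (\<lambda>x y. min (x + y) 1), mv_neg = (\<lambda>x. 1 - x), mv_zero = 0\<rparr>"

definition mv_simple :: "('a, 'b) mv_struct_scheme \<Rightarrow> bool"
  where "mv_simple A \<longleftrightarrow> mv_chain A \<and> (\<exists>f. mv_embedding A mv_unit_interval f)"

lemma mv_chain_unit_interval: "mv_chain mv_unit_interval"
proof
  fix x y :: real
  assume "x \<in> carrier mv_unit_interval" "y \<in> carrier mv_unit_interval"
  then have "x \<le> y \<Longrightarrow> mv_le mv_unit_interval x y" "y \<le> x \<Longrightarrow> mv_le mv_unit_interval y x"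
    unfolding mv_le_def
    by (auto simp: mv_unit_interval_def intro: bexI[of _ "y - x"] bexI[of _ "x - y"])
  then show "mv_le mv_unit_interval x y \<or> mv_le mv_unit_interval y x"
    by linarith
qed (auto simp: mv_unit_interval_def mv_one_def min_def)


section \<open>First-order logic over the language \<open>(0, \<oplus>, \<not>)\<close>\<close>

datatype mv_term = Var nat | Zero | Plus mv_term mv_term | Neg mv_term

datatype mv_form =
    Eq mv_term mv_term
  | Falsum
  | Imp mv_form mv_form
  | All nat mv_form

primrec term_vars :: "mv_term \<Rightarrow> nat set"
  where
    "term_vars (Var i) = {i}"
  | "term_vars Zero = {}"
  | "term_vars (Plus s t) = term_vars s \<union> term_vars t"
  | "term_vars (Neg t) = term_vars t"

primrec free_vars :: "mv_form \<Rightarrow> nat set"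
  where
    "free_vars (Eq s t) = term_vars s \<union> term_vars t"
  | "free_vars Falsum = {}"
  | "free_vars (Imp p q) = free_vars p \<union> free_vars q"
  | "free_vars (All i p) = free_vars p - {i}"

definition mv_sentence :: "mv_form \<Rightarrow> bool"
  where "mv_sentence p \<longleftrightarrow> free_vars p = {}"

primrec term_val :: "('a, 'b) mv_struct_scheme \<Rightarrow> (nat \<Rightarrow> 'a) \<Rightarrow> mv_term \<Rightarrow> 'a"
  where
    "term_val A e (Var i) = e i"
  | "term_val A e Zero = \<zero>\<^bsub>A\<^esub>"
  | "term_val A e (Plus s t) = term_val A e s \<oplus>\<^bsub>A\<^esub> term_val A e t"
  | "term_val A e (Neg t) = \<sim>\<^bsub>A\<^esub> (term_val A e t)"

primrec sat :: "('a, 'b) mv_struct_scheme \<Rightarrow> (nat \<Rightarrow> 'a) \<Rightarrow> mv_form \<Rightarrow> bool"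
  where
    "sat A e (Eq s t) \<longleftrightarrow> term_val A e s = term_val A e t"
  | "sat A e Falsum \<longleftrightarrow> False"
  | "sat A e (Imp p q) \<longleftrightarrow> (sat A e p \<longrightarrow> sat A e q)"
  | "sat A e (All i p) \<longleftrightarrow> (\<forall>a\<in>carrier A. sat A (e(i := a)) p)"

definition mv_models :: "('a, 'b) mv_struct_scheme \<Rightarrow> mv_form \<Rightarrow> bool"
  where "mv_models A p \<longleftrightarrow> (\<forall>e. range e \<subseteq> carrier A \<longrightarrow> sat A e p)"

text \<open>A definition cannot quantify over all types, so the simple MV-chains are taken with
  carriers in \<open>real\<close>. Every simple MV-chain is isomorphic to one of these; lemma
  \<open>mv_models_of_simple\<close> below shows that simple MV-chains over other types satisfy the
  same sentences.\<close>

definition pseudo_simple :: "('a, 'b) mv_struct_scheme \<Rightarrow> bool"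
  where "pseudo_simple A \<longleftrightarrow>
    (\<forall>p. mv_sentence p \<and> (\<forall>B :: real mv_struct. mv_simple B \<longrightarrow> mv_models B p) \<longrightarrow>
      mv_models A p)"

lemma term_val_closed:
  assumes "mv_algebra A" "range e \<subseteq> carrier A"
  shows "term_val A e t \<in> carrier A"
  using assms
  by (induction t) (auto simp: mv_algebra.zero_closed mv_algebra.plus_closed mv_algebra.neg_closed)

lemma term_val_embedding:
  assumes "mv_algebra A" "mv_embedding A B f" "range e \<subseteq> carrier A"
  shows "term_val B (f \<circ> e) t = f (term_val A e t)"
  using assms term_val_closed[OF assms(1,3)]
  by (induction t) (auto simp: mv_embedding_def)

lemma sat_embedding_onto:
  assumes "mv_algebra A" "mv_embedding A B f" "f ` carrier A = carrier B" "range e \<subseteq> carrier A"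
  shows "sat B (f \<circ> e) p \<longleftrightarrow> sat A e p"
  using assms(4)
proof (induction p arbitrary: e)
  case (Eq s t)
  have "inj_on f (carrier A)"
    using assms(2) by (simp add: mv_embedding_def)
  then show ?case
    unfolding sat.simps term_val_embedding[OF assms(1,2) Eq]
    by (simp add: inj_on_eq_iff term_val_closed[OF assms(1) Eq])
next
  case (All i p)
  have "sat B ((f \<circ> e)(i := f a)) p \<longleftrightarrow> sat A (e(i := a)) p" if "a \<in> carrier A" for a
  proof -
    have "range (e(i := a)) \<subseteq> carrier A"
      using that All.prems by auto
    moreover have "f \<circ> e(i := a) = (f \<circ> e)(i := f a)"
      by auto
    ultimately show ?thesis
      using All.IH by metis
  qed
  then show ?case
    unfolding sat.simps assms(3)[symmetric] by blast
qed auto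

lemma mv_simple_iso_real:
  fixes A :: "('a, 'b) mv_struct_scheme"
  assumes "mv_simple A"
  obtains B :: "real mv_struct" and f
  where "mv_simple B" "mv_embedding A B f" "f ` carrier A = carrier B"
proof -
  interpret mv_chain A
    using assms by (simp add: mv_simple_def)
  obtain f where f: "mv_embedding A mv_unit_interval f"
    using assms by (auto simp: mv_simple_def)
  define B where "B = mv_unit_interval\<lparr>carrier := f ` carrier A\<rparr>"
  have ops: "carrier B = f ` carrier A" "mv_plus B = mv_plus mv_unit_interval"
    "mv_neg B = mv_neg mv_unit_interval" "mv_zero B = mv_zero mv_unit_interval"
    by (simp_all add: B_def)
  have emb: "mv_embedding A B f"
    using f by (auto simp: mv_embedding_def ops)
  then have h: "\<zero>\<^bsub>B\<^esub> = f \<zero>\<^bsub>A\<^esub>"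
    "\<And>x. x \<in> carrier A \<Longrightarrow> \<sim>\<^bsub>B\<^esub> (f x) = f (\<sim>\<^bsub>A\<^esub> x)"
    "\<And>x y. x \<in> carrier A \<Longrightarrow> y \<in> carrier A \<Longrightarrow> f x \<oplus>\<^bsub>B\<^esub> f y = f (x \<oplus>\<^bsub>A\<^esub> y)"
    by (auto simp: mv_embedding_def)
  have one: "\<one>\<^bsub>B\<^esub> = f \<one>\<^bsub>A\<^esub>"
    by (simp add: mv_one_def h zero_closed)
  have "mv_chain B"
  proof
    show "mv_le B x y \<or> mv_le B y x" if xy: "x \<in> carrier B" "y \<in> carrier B" for x y
    proof -
      obtain a b where ab: "a \<in> carrier A" "b \<in> carrier A" "x = f a" "y = f b"
        using xy unfolding ops(1) by blast
      have "mv_le A a b \<or> mv_le A b a"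
        using ab linear by blast
      then show ?thesis
        using ab by (force simp: mv_le_def ops(1) h)
    qed
  qed (auto simp: ops(1) h one zero_closed plus_closed neg_closed plus_assoc plus_zero neg_neg
      plus_one[unfolded mv_one_def] mv_one_def, (metis plus_comm lukasiewicz)+)
  moreover have "mv_embedding B mv_unit_interval id"
    using f by (auto simp: mv_embedding_def ops)
  ultimately have "mv_simple B"
    by (auto simp: mv_simple_def)
  with emb ops(1) that show thesis
    by metis
qed

lemma mv_models_of_simple:
  fixes A :: "('a, 'b) mv_struct_scheme"
  assumes "\<forall>B :: real mv_struct. mv_simple B \<longrightarrow> mv_models B p" "mv_simple A"
  shows "mv_models A p"
proof -
  obtain B :: "real mv_struct" and f
    where B: "mv_simple B" "mv_embedding A B f" "f ` carrier A = carrier B"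
    using mv_simple_iso_real[OF assms(2)] .
  have A: "mv_algebra A"
    using assms(2) by (simp add: mv_simple_def mv_chain_def)
  show ?thesis
    unfolding mv_models_def
  proof (intro allI impI)
    fix e :: "nat \<Rightarrow> 'a"
    assume e: "range e \<subseteq> carrier A"
    then have "range (f \<circ> e) \<subseteq> carrier B"
      using B(3) by auto
    then have "sat B (f \<circ> e) p"
      using assms(1) B(1) by (simp add: mv_models_def)
    then show "sat A e p"
      using sat_embedding_onto[OF A B(2,3) e] by simp
  qed
qed

end

theory Submission
  imports Defs "HOL-Algebra.Group" "HOL-Analysis.Continuum_Not_Denumerable"
begin

text \<open>An MV-chain is the unit segment of a totally ordered abelian group \<open>G\<close> with strong unit
  (Chang), and for a densely ordered \<open>G\<close> regularity says that every interval contains a multiple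
  of every \<open>n > 0\<close>. This is a first-order property that holds in the atomless simple chains, so
  pseudo-simple atomless chains are regular.

  Conversely, by Loewenheim-Skolem the chain may be assumed countable. Then \<open>G\<close> embeds into the
  reals as a group, forgetting its order, with the unit going to \<open>1\<close>. The image \<open>H\<close> carries
  two orders that both make it regularly dense: the one transported from \<open>G\<close> and the usual one.
  A back-and-forth argument shows that the unit segments of the two orders satisfy the same
  sentences, and the segment of the usual order is a simple MV-chain. Since both sides share the group
  \<open>H\<close>, divisibility is controlled by keeping corresponding elements congruent modulo a
  large integer, so that the indices \<open>[H : n H]\<close> never enter.\<close>

section \<open>Arithmetic in MV-chains\<close>

text \<open>A regular chain may contain infinitesimals, so an order-preserving map into the reals
  need not exist; this is why the order is dropped and only the group is embedded. Countability is
  what makes room in the reals: each new element has to avoid only countably many values. Regularly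
  dense groups with different indices need not be elementarily equivalent, so an arbitrary dense
  subgroup of the reals would not do as the second structure; the same \<open>H\<close> has to be
  used. It remains to see that the usual order on \<open>H\<close> is dense: otherwise
  \<open>H\<close> would be cyclic, and then its other order would have a least positive
  element.\<close>

definition mv_diff :: "('a, 'b) mv_struct_scheme \<Rightarrow> 'a \<Rightarrow> 'a \<Rightarrow> 'a"  (infixl "\<ominus>\<index>" 65)
  where "x \<ominus>\<^bsub>A\<^esub> y = \<sim>\<^bsub>A\<^esub> (\<sim>\<^bsub>A\<^esub> x \<oplus>\<^bsub>A\<^esub> y)"

context mv_algebra
begin

lemma one_closed: "\<one> \<in> carrier A"
  by (simp add: mv_one_def neg_closed zero_closed)

lemma diff_closed: "x \<in> carrier A \<Longrightarrow> y \<in> carrier A \<Longrightarrow> x \<ominus> y \<in> carrier A"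
  by (simp add: mv_diff_def neg_closed plus_closed)

lemmas closed [simp] = zero_closed one_closed plus_closed neg_closed diff_closed

lemma nmult_closed [simp]: "x \<in> carrier A \<Longrightarrow> mv_nmult A n x \<in> carrier A"
  by (induction n) auto

lemma neg_simps [simp]: "\<sim> \<one> = \<zero>" "\<sim> \<zero> = \<one>"
  by (simp_all add: mv_one_def neg_neg zero_closed)

lemma neg_neg' [simp]: "x \<in> carrier A \<Longrightarrow> \<sim> (\<sim> x) = x"
  by (rule neg_neg)

lemma plus_simps [simp]:
  assumes "x \<in> carrier A"
  shows "x \<oplus> \<zero> = x" "\<zero> \<oplus> x = x" "x \<oplus> \<one> = \<one>" "\<one> \<oplus> x = \<one>"
  using assms by (metis plus_zero plus_one plus_comm zero_closed one_closed)+

lemma neg_plus [simp]: "x \<in> carrier A \<Longrightarrow> \<sim> x \<oplus> x = \<one>" "x \<in> carrier A \<Longrightarrow> x \<oplus> \<sim> x = \<one>"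
  using lukasiewicz[of x "\<one>"] by (auto simp: plus_comm)

text \<open>In the unit interval \<open>x \<ominus> y\<close> is max(x - y, 0), so both sides are
  the maximum of \<open>x\<close> and \<open>y\<close>.\<close>

lemma diff_plus_comm: "x \<in> carrier A \<Longrightarrow> y \<in> carrier A \<Longrightarrow> (x \<ominus> y) \<oplus> y = (y \<ominus> x) \<oplus> x"
  unfolding mv_diff_def by (rule lukasiewicz)

lemma le_iff:
  assumes "x \<in> carrier A" "y \<in> carrier A"
  shows "mv_le A x y \<longleftrightarrow> \<sim> x \<oplus> y = \<one>"
proof
  assume "mv_le A x y"
  then obtain z where "z \<in> carrier A" "x \<oplus> z = y" by (auto simp: mv_le_def)
  then show "\<sim> x \<oplus> y = \<one>"
    using assms by (metis neg_closed neg_plus(1) plus_assoc plus_simps(4))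
next
  assume *: "\<sim> x \<oplus> y = \<one>"
  have "x \<oplus> (y \<ominus> x) = y"
    using diff_plus_comm[OF assms] assms * by (simp add: plus_comm mv_diff_def)
  then show "mv_le A x y"
    using assms unfolding mv_le_def by (metis diff_closed)
qed

lemma diff_eq_zero_iff:
  "x \<in> carrier A \<Longrightarrow> y \<in> carrier A \<Longrightarrow> x \<ominus> y = \<zero> \<longleftrightarrow> mv_le A x y"
  by (metis le_iff mv_diff_def neg_closed neg_neg neg_simps plus_closed)

lemma plus_diff:
  assumes "mv_le A x y" "x \<in> carrier A" "y \<in> carrier A"
  shows "x \<oplus> (y \<ominus> x) = y"
  using assms by (metis diff_closed diff_eq_zero_iff diff_plus_comm plus_comm plus_simps(2))

lemma le_refl: "x \<in> carrier A \<Longrightarrow> mv_le A x x"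
  by (simp add: le_iff)

lemma le_antisym:
  "mv_le A x y \<Longrightarrow> mv_le A y x \<Longrightarrow> x \<in> carrier A \<Longrightarrow> y \<in> carrier A \<Longrightarrow> x = y"
  by (metis plus_diff diff_eq_zero_iff plus_simps(1))

lemma le_trans:
  assumes "mv_le A x y" "mv_le A y z" "x \<in> carrier A"
  shows "mv_le A x z"
proof -
  obtain a b where "a \<in> carrier A" "x \<oplus> a = y" "b \<in> carrier A" "y \<oplus> b = z"
    using assms(1,2) unfolding mv_le_def by blast
  with assms(3) have "x \<oplus> (a \<oplus> b) = z" "a \<oplus> b \<in> carrier A"
    by (simp_all flip: plus_assoc)
  then show ?thesis
    unfolding mv_le_def by blast
qed

lemma zero_le: "x \<in> carrier A \<Longrightarrow> mv_le A \<zero> x"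
  and le_one: "x \<in> carrier A \<Longrightarrow> mv_le A x \<one>"
  by (simp_all add: le_iff)

lemma le_plus: "x \<in> carrier A \<Longrightarrow> y \<in> carrier A \<Longrightarrow> mv_le A x (x \<oplus> y)"
  by (auto simp: mv_le_def)

lemma neg_le_iff: "x \<in> carrier A \<Longrightarrow> y \<in> carrier A \<Longrightarrow> mv_le A (\<sim> x) y \<longleftrightarrow> x \<oplus> y = \<one>"
  by (simp add: le_iff)

lemma zero_less_iff: "x \<in> carrier A \<Longrightarrow> mv_less A \<zero> x \<longleftrightarrow> x \<noteq> \<zero>"
  by (auto simp: mv_less_def zero_le)

lemma plus_mono:
  assumes "mv_le A x y" "x \<in> carrier A" "z \<in> carrier A"
  shows "mv_le A (x \<oplus> z) (y \<oplus> z)"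
proof -
  obtain a where "a \<in> carrier A" "x \<oplus> a = y"
    using assms(1) unfolding mv_le_def by blast
  with assms have "(x \<oplus> z) \<oplus> a = y \<oplus> z"
    by (metis plus_assoc plus_comm)
  then show ?thesis
    using \<open>a \<in> carrier A\<close> unfolding mv_le_def by blast
qed

lemma diff_diff: 
  "x \<in> carrier A \<Longrightarrow> y \<in> carrier A \<Longrightarrow> z \<in> carrier A \<Longrightarrow> x \<ominus> (y \<oplus> z) = (x \<ominus> y) \<ominus> z"
  by (simp add: mv_diff_def plus_assoc)

lemma plus_diff_cancel_le:
  assumes "mv_le A y (\<sim> x)" "x \<in> carrier A" "y \<in> carrier A"
  shows "(x \<oplus> y) \<ominus> x = y"
proof -
  have "(x \<oplus> y) \<ominus> x = \<sim> ((\<sim> x \<ominus> y) \<oplus> x)"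
    using assms by (simp add: mv_diff_def)
  also have "(\<sim> x \<ominus> y) \<oplus> x = \<sim> y"
  proof -
    have "\<sim> x \<ominus> y = \<sim> y \<ominus> x"
      using assms by (simp add: mv_diff_def plus_comm)
    moreover have "mv_le A x (\<sim> y)"
      using assms by (simp add: le_iff plus_comm)
    ultimately show ?thesis
      using plus_diff[of x "\<sim> y"] assms by (simp add: plus_comm)
  qed
  finally show ?thesis
    using assms by simp
qed

end

context mv_chain
begin

lemma not_le: "x \<in> carrier A \<Longrightarrow> y \<in> carrier A \<Longrightarrow> \<not> mv_le A x y \<longleftrightarrow> mv_less A y x"
  using linear[of x y] le_refl le_antisym unfolding mv_less_def by metis

text \<open>Cancellation fails only through truncation: by linearity either \<open>y\<close> is at
  most \<open>\<sim> x\<close>, and nothing is truncated, or the sum is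
  \<open>\<one>\<close>.\<close>

lemma plus_diff_cancel:
  assumes "x \<oplus> y \<noteq> \<one>" "x \<in> carrier A" "y \<in> carrier A"
  shows "(x \<oplus> y) \<ominus> x = y"
  using assms by (metis neg_le_iff linear neg_closed plus_diff_cancel_le)

lemma plus_diff_cancel_right:
  assumes "x \<oplus> y \<noteq> \<one>" "x \<in> carrier A" "y \<in> carrier A"
  shows "(x \<oplus> y) \<ominus> y = x"
  using assms plus_diff_cancel plus_comm by metis

lemma less_le_trans:
  "mv_less A x y \<Longrightarrow> mv_le A y z \<Longrightarrow> x \<in> carrier A \<Longrightarrow> y \<in> carrier A \<Longrightarrow> mv_less A x z"
  unfolding mv_less_def by (metis le_antisym le_trans)

lemma le_less_trans:
  "mv_le A x y \<Longrightarrow> mv_less A y z \<Longrightarrow> x \<in> carrier A \<Longrightarrow> y \<in> carrier A \<Longrightarrow> mv_less A x z"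
  unfolding mv_less_def by (metis le_antisym le_trans)

lemma plus_less:
  assumes "x \<in> carrier A" "e \<in> carrier A" "e \<noteq> \<zero>" "x \<noteq> \<one>"
  shows "mv_less A x (x \<oplus> e)"
  using assms unfolding mv_less_def
  by (metis diff_eq_zero_iff le_plus le_refl plus_diff_cancel)

end

section \<open>Density and regularity in terms of two endpoints\<close>

definition mv_dense :: "('a, 'b) mv_struct_scheme \<Rightarrow> bool"
  where "mv_dense A \<longleftrightarrow> (\<forall>x\<in>carrier A. x \<noteq> \<zero>\<^bsub>A\<^esub> \<longrightarrow>
    (\<exists>y\<in>carrier A. y \<noteq> \<zero>\<^bsub>A\<^esub> \<and> mv_less A y x))"

text \<open>The conclusion of \<open>mv_regular\<close> mentions only the ends of the given chain;
  in a dense algebra the inner members can be supplied, which leaves this condition.\<close>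

definition mv_regular_between :: "('a, 'b) mv_struct_scheme \<Rightarrow> nat \<Rightarrow> bool"
  where "mv_regular_between A n \<longleftrightarrow>
    (\<forall>x\<in>carrier A. \<forall>z\<in>carrier A. x \<noteq> \<zero>\<^bsub>A\<^esub> \<and> mv_less A x z \<longrightarrow>
      (\<exists>y\<in>carrier A. mv_le A x (mv_nmult A n y) \<and> mv_le A (mv_nmult A n y) z \<and>
        (\<forall>k<n. mv_less A (mv_nmult A k y) (mv_nmult A (Suc k) y))))"

context mv_chain
begin

lemma atomless_iff_dense: "mv_atomless A \<longleftrightarrow> mv_dense A"
  unfolding mv_atomless_def mv_atom_def mv_dense_def mv_less_def
  by (metis zero_le)

text \<open>A nonzero \<open>e\<close> below the gap \<open>d = z \<ominus> x\<close> is added to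
  \<open>x\<close>, which carries density at zero to any position. Cancelling \<open>x\<close> shows
  that \<open>x \<oplus> e\<close> stays strictly below \<open>z\<close>.\<close>

lemma dense_between:
  assumes "mv_dense A" "mv_less A x z" "x \<in> carrier A" "z \<in> carrier A"
  obtains y where "y \<in> carrier A" "mv_less A x y" "mv_less A y z"
proof -
  have le: "mv_le A x z" and ne: "x \<noteq> z"
    using assms(2) by (auto simp: mv_less_def)
  define d where "d = z \<ominus> x"
  have d: "d \<in> carrier A" "x \<oplus> d = z"
    using assms le by (simp_all add: d_def plus_diff)
  then have "d \<noteq> \<zero>" "x \<noteq> \<one>"
    using ne assms by auto
  then obtain e where e: "e \<in> carrier A" "e \<noteq> \<zero>" "mv_less A e d"
    using assms(1) d unfolding mv_dense_def by blast
  have "mv_le A (x \<oplus> e) (x \<oplus> d)"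
    using e assms d plus_mono[of e d x] by (simp add: mv_less_def plus_comm)
  moreover have "x \<oplus> e \<noteq> z"
  proof
    assume eq: "x \<oplus> e = z"
    have "mv_le A d (\<sim> x)"
      using assms by (simp add: d_def mv_diff_def le_iff plus_assoc)
    moreover then have "mv_le A e (\<sim> x)"
      using e assms d by (metis le_trans mv_less_def)
    ultimately have "e = d"
      using plus_diff_cancel_le[of _ x] assms d e eq by metis
    then show False
      using e by (simp add: mv_less_def)
  qed
  ultimately have "mv_less A (x \<oplus> e) z"
    using d by (simp add: mv_less_def)
  then show thesis
    using that[of "x \<oplus> e"] plus_less[OF assms(3) e(1,2) \<open>x \<noteq> \<one>\<close>] assms e by simp
qed

lemma regular_iff_between:
  assumes "mv_dense A"
  shows "mv_regular A \<longleftrightarrow> (\<forall>n\<ge>2. mv_regular_between A n)"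
proof safe
  fix n :: nat
  assume reg: "mv_regular A" and n: "n \<ge> 2"
  show "mv_regular_between A n"
    unfolding mv_regular_between_def
  proof (intro ballI impI, elim conjE)
    fix x z
    assume xz: "x \<in> carrier A" "z \<in> carrier A" "x \<noteq> \<zero>" "mv_less A x z"
    \<comment> \<open>Keeping every \<open>f i\<close> strictly below \<open>z\<close> leaves room
      for the next one. The points \<open>f 1\<close>, ..., \<open>f n\<close> then serve as the
      chain in \<open>mv_regular\<close>.\<close>
    have "\<exists>f. \<forall>i::nat. (f i \<in> carrier A \<and> mv_le A x (f i) \<and> mv_less A (f i) z) \<and> mv_less A (f i) (f (Suc i))"
    proof (rule dependent_nat_choice)
      show "\<exists>y. y \<in> carrier A \<and> mv_le A x y \<and> mv_less A y z"
        using xz le_refl by blast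
      fix y :: 'a and i :: nat
      assume y: "y \<in> carrier A \<and> mv_le A x y \<and> mv_less A y z"
      then obtain w where "w \<in> carrier A" "mv_less A y w" "mv_less A w z"
        using dense_between assms xz by metis
      then show "\<exists>w. (w \<in> carrier A \<and> mv_le A x w \<and> mv_less A w z) \<and> mv_less A y w"
        using y xz by (metis le_trans mv_less_def)
    qed
    then obtain f :: "nat \<Rightarrow> 'a" where f: "\<And>i. f i \<in> carrier A" "\<And>i. mv_le A x (f i)"
      "\<And>i. mv_less A (f i) z" "\<And>i. mv_less A (f i) (f (Suc i))"
      by blast
    have "mv_less A \<zero> (f 1)"
      using f xz by (metis zero_less_iff le_antisym zero_le)
    then obtain y where y: "y \<in> carrier A" "mv_le A (f 1) (mv_nmult A n y)"
      "mv_le A (mv_nmult A n y) (f n)"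
      "\<forall>k<n. mv_less A (mv_nmult A k y) (mv_nmult A (Suc k) y)"
      using reg n f unfolding mv_regular_def by meson
    then show "\<exists>y\<in>carrier A. mv_le A x (mv_nmult A n y) \<and> mv_le A (mv_nmult A n y) z \<and>
        (\<forall>k<n. mv_less A (mv_nmult A k y) (mv_nmult A (Suc k) y))"
      using f xz by (meson le_trans mv_less_def nmult_closed)
  qed
next
  assume reg: "\<forall>n\<ge>2. mv_regular_between A n"
  show "mv_regular A"
    unfolding mv_regular_def
  proof (intro allI impI, elim conjE)
    fix n :: nat and x :: "nat \<Rightarrow> 'a"
    assume n: "2 \<le> n" and x: "\<forall>i\<in>{1..n}. x i \<in> carrier A" "mv_less A \<zero> (x 1)"
      "\<forall>i\<in>{1..<n}. mv_less A (x i) (x (Suc i))"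
    have "i \<le> n \<Longrightarrow> mv_less A (x 1) (x i)" if "2 \<le> i" for i
      using that
    proof (induction i rule: dec_induct)
      case base
      then show ?case
        using bspec[OF x(3), of 1] by (simp add: numeral_2_eq_2)
    next
      case (step i)
      then show ?case
        using less_le_trans[of "x 1" "x i" "x (Suc i)"] x by (auto simp: mv_less_def)
    qed
    then have "mv_less A (x 1) (x n)"
      using n by blast
    moreover have "x 1 \<in> carrier A" "x n \<in> carrier A" "x 1 \<noteq> \<zero>"
      using x n by (auto simp: mv_less_def)
    ultimately show "\<exists>y\<in>carrier A. mv_le A (x 1) (mv_nmult A n y) \<and> mv_le A (mv_nmult A n y) (x n) \<and>
        (\<forall>k<n. mv_less A (mv_nmult A k y) (mv_nmult A (Suc k) y))"
      using reg n unfolding mv_regular_between_def by blast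
  qed
qed

end

section \<open>Chang's group\<close>

text \<open>The pair \<open>(m, a)\<close> stands for m + a with 0 \<le> a < 1. When the fractional
  parts reach the unit, 1 is carried and a + b - 1 remains, which is
  \<open>a \<ominus> \<sim> b\<close>. The order of the group enters only later, as a cone in its
  real image.\<close>

definition chang_add :: "('a, 'b) mv_struct_scheme \<Rightarrow> int \<times> 'a \<Rightarrow> int \<times> 'a \<Rightarrow> int \<times> 'a"
  where "chang_add A p q =
    (if snd p \<oplus>\<^bsub>A\<^esub> snd q = mv_one A then (fst p + fst q + 1, snd p \<ominus>\<^bsub>A\<^esub> \<sim>\<^bsub>A\<^esub> (snd q))
     else (fst p + fst q, snd p \<oplus>\<^bsub>A\<^esub> snd q))"

definition chang_group :: "('a, 'b) mv_struct_scheme \<Rightarrow> (int \<times> 'a) monoid"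
  where "chang_group A =
    \<lparr>carrier = UNIV \<times> (carrier A - {mv_one A}), mult = chang_add A, one = (0, \<zero>\<^bsub>A\<^esub>)\<rparr>"

context mv_algebra
begin

lemma diff_neg_comm: "x \<in> carrier A \<Longrightarrow> y \<in> carrier A \<Longrightarrow> x \<ominus> \<sim> y = y \<ominus> \<sim> x"
  by (simp add: mv_diff_def plus_comm)

lemma diff_neg_plus: "x \<oplus> y = \<one> \<Longrightarrow> x \<in> carrier A \<Longrightarrow> y \<in> carrier A \<Longrightarrow> (x \<ominus> \<sim> y) \<oplus> \<sim> y = x"
  using plus_diff[of "\<sim> y" x] by (simp add: le_iff plus_comm)

lemma diff_self: "x \<in> carrier A \<Longrightarrow> x \<ominus> x = \<zero>"
  by (simp add: mv_diff_def)

lemma plus_eq_zero: "x \<oplus> y = \<zero> \<Longrightarrow> x \<in> carrier A \<Longrightarrow> y \<in> carrier A \<Longrightarrow> x = \<zero>"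
  by (metis le_antisym le_plus zero_closed zero_le)

lemma neg_eq_iff [simp]:
  "x \<in> carrier A \<Longrightarrow> \<sim> x = \<one> \<longleftrightarrow> x = \<zero>" "x \<in> carrier A \<Longrightarrow> \<sim> x = \<zero> \<longleftrightarrow> x = \<one>"
  by (metis neg_neg' neg_simps)+

lemma diff_neg_neq_one: "x \<in> carrier A \<Longrightarrow> y \<in> carrier A \<Longrightarrow> x \<noteq> \<one> \<Longrightarrow> x \<ominus> \<sim> y \<noteq> \<one>"
  using plus_eq_zero[of "\<sim> x" "\<sim> y"] by (simp add: mv_diff_def) blast

end

context mv_chain
begin

text \<open>Associativity of \<open>chang_add\<close> is split according to which of the sums \<open>a + b\<close> and
  \<open>b + c\<close> produce a carry.\<close>

lemma carry_assoc_right: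
  assumes "a \<oplus> b \<noteq> \<one>" "b \<oplus> c = \<one>" and [simp]: "a \<in> carrier A" "b \<in> carrier A" "c \<in> carrier A"
  shows "a \<oplus> b \<oplus> c = \<one>" "(a \<oplus> b) \<ominus> \<sim> c = a \<oplus> (b \<ominus> \<sim> c)" "a \<oplus> (b \<ominus> \<sim> c) \<noteq> \<one>"
proof -
  show "a \<oplus> b \<oplus> c = \<one>"
    using assms(2) by (simp add: plus_assoc)
  \<comment> \<open>Adding 1 - c to a + (b + c - 1) gives a + b, which is below the unit, so 1 - c
    can be cancelled.\<close>
  have t: "(a \<oplus> (b \<ominus> \<sim> c)) \<oplus> \<sim> c = a \<oplus> b"
    using diff_neg_plus[OF assms(2)] by (simp add: plus_assoc)
  show "(a \<oplus> b) \<ominus> \<sim> c = a \<oplus> (b \<ominus> \<sim> c)"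
    using plus_diff_cancel_right[of "a \<oplus> (b \<ominus> \<sim> c)" "\<sim> c"] t assms(1) by simp
  show "a \<oplus> (b \<ominus> \<sim> c) \<noteq> \<one>"
    using t assms(1) by auto
qed

lemma carry_assoc_outer:
  assumes "a \<oplus> b \<noteq> \<one>" "b \<oplus> c \<noteq> \<one>" "a \<oplus> b \<oplus> c = \<one>"
    and [simp]: "a \<in> carrier A" "b \<in> carrier A" "c \<in> carrier A"
  shows "(a \<oplus> b) \<ominus> \<sim> c = a \<ominus> \<sim> (b \<oplus> c)"
proof -
  \<comment> \<open>Here \<open>t\<close> is a + b + c - 1 and \<open>d\<close> is 1 - (b + c), so t
    + d = a is expected. It follows by cancelling \<open>b\<close>, because b + d = 1 - c.\<close>
  define t where "t = (a \<oplus> b) \<ominus> \<sim> c"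
  define d where "d = \<sim> (b \<oplus> c)"
  have [simp]: "t \<in> carrier A" "d \<in> carrier A"
    by (simp_all add: t_def d_def)
  have t: "t \<oplus> \<sim> c = a \<oplus> b"
    using diff_neg_plus[OF assms(3)] by (simp add: t_def)
  have "\<not> mv_le A (\<sim> c) b"
    using assms(2) by (simp add: neg_le_iff plus_comm)
  then have "mv_le A b (\<sim> c)"
    using linear[of b "\<sim> c"] by simp
  then have "b \<oplus> (\<sim> c \<ominus> b) = \<sim> c"
    by (rule plus_diff) simp_all
  moreover have "\<sim> c \<ominus> b = d"
    by (simp add: d_def mv_diff_def plus_comm)
  moreover have "(t \<oplus> d) \<oplus> b = t \<oplus> (b \<oplus> d)"
    by (simp add: plus_assoc plus_comm[of d b])
  ultimately have eq: "(t \<oplus> d) \<oplus> b = a \<oplus> b"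
    using t by simp
  have "t \<oplus> d = ((t \<oplus> d) \<oplus> b) \<ominus> b"
    by (rule plus_diff_cancel_right[symmetric]) (simp_all add: eq assms(1))
  also have "\<dots> = a"
    unfolding eq by (rule plus_diff_cancel_right) (simp_all add: assms(1))
  finally have td: "t \<oplus> d = a" .
  moreover have "a \<noteq> \<one>"
    using assms(1) by auto
  ultimately have "a \<ominus> d = t"
    using plus_diff_cancel_right[of t d] by simp
  then show ?thesis
    by (simp add: t_def d_def)
qed

lemma carry_assoc_both:
  assumes "a \<oplus> b = \<one>" "b \<oplus> c = \<one>" and [simp]: "a \<in> carrier A" "b \<in> carrier A" "c \<in> carrier A"
  shows "(a \<ominus> \<sim> b) \<oplus> c = a \<oplus> (b \<ominus> \<sim> c)" "(a \<ominus> \<sim> b) \<ominus> \<sim> c = a \<ominus> \<sim> (b \<ominus> \<sim> c)"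
proof -
  have "(b \<ominus> \<sim> c) \<oplus> \<sim> b = c"
    using diff_neg_plus[of c b] assms(2) by (simp add: diff_neg_comm plus_comm)
  moreover have "(a \<ominus> \<sim> b) \<oplus> \<sim> b = a"
    using diff_neg_plus[OF assms(1)] by simp
  ultimately have "(a \<ominus> \<sim> b) \<oplus> ((b \<ominus> \<sim> c) \<oplus> \<sim> b) = (a \<ominus> \<sim> b) \<oplus> c"
    "((a \<ominus> \<sim> b) \<oplus> \<sim> b) \<oplus> (b \<ominus> \<sim> c) = a \<oplus> (b \<ominus> \<sim> c)"
    by simp_all
  then show "(a \<ominus> \<sim> b) \<oplus> c = a \<oplus> (b \<ominus> \<sim> c)"
    by (metis (no_types, lifting) assms(3-5) plus_assoc plus_comm diff_closed neg_closed)
  have "\<sim> (b \<ominus> \<sim> c) = \<sim> b \<oplus> \<sim> c"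
    by (simp add: mv_diff_def)
  then show "(a \<ominus> \<sim> b) \<ominus> \<sim> c = a \<ominus> \<sim> (b \<ominus> \<sim> c)"
    by (simp add: diff_diff)
qed

lemma chang_add_assoc:
  assumes [simp]: "snd p \<in> carrier A" "snd q \<in> carrier A" "snd r \<in> carrier A"
  shows "chang_add A (chang_add A p q) r = chang_add A p (chang_add A q r)"
proof -
  let ?a = "snd p" and ?b = "snd q" and ?c = "snd r"
  consider "?a \<oplus> ?b \<noteq> \<one>" "?b \<oplus> ?c \<noteq> \<one>" | "?a \<oplus> ?b \<noteq> \<one>" "?b \<oplus> ?c = \<one>"
    | "?a \<oplus> ?b = \<one>" "?b \<oplus> ?c \<noteq> \<one>" | "?a \<oplus> ?b = \<one>" "?b \<oplus> ?c = \<one>"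
    by blast
  then show ?thesis
  proof cases
    case 1
    then show ?thesis
      using carry_assoc_outer[of ?a ?b ?c] by (auto simp: chang_add_def plus_assoc)
  next
    case 2
    then show ?thesis
      using carry_assoc_right[of ?a ?b ?c] by (auto simp: chang_add_def)
  next
    case 3
    \<comment> \<open>By commutativity this is the second case with the outer elements
      exchanged.\<close>
    then have "?c \<oplus> ?b \<noteq> \<one>" "?b \<oplus> ?a = \<one>"
      by (simp_all add: plus_comm)
    note * = carry_assoc_right[OF this, simplified]
    have "?a \<oplus> (?b \<oplus> ?c) = \<one>" "?a \<ominus> \<sim> (?b \<oplus> ?c) = (?a \<ominus> \<sim> ?b) \<oplus> ?c" "(?a \<ominus> \<sim> ?b) \<oplus> ?c \<noteq> \<one>"
      using * diff_neg_comm[of ?a ?b] diff_neg_comm[of ?a "?b \<oplus> ?c"] by (simp_all add: plus_comm)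
    then show ?thesis
      using 3 by (auto simp: chang_add_def)
  next
    case 4
    then show ?thesis
      using carry_assoc_both[of ?a ?b ?c] by (auto simp: chang_add_def)
  qed
qed

lemma comm_group_chang_group:
  assumes "\<zero> \<noteq> mv_one A"
  shows "comm_group (chang_group A)"
proof (rule comm_groupI)
  fix x y assume xy: "x \<in> carrier (chang_group A)" "y \<in> carrier (chang_group A)"
  then show "x \<otimes>\<^bsub>chang_group A\<^esub> y \<in> carrier (chang_group A)"
    using diff_neg_neq_one by (auto simp: chang_group_def chang_add_def)
  show "x \<otimes>\<^bsub>chang_group A\<^esub> y = y \<otimes>\<^bsub>chang_group A\<^esub> x"
    using xy by (auto simp: chang_group_def chang_add_def plus_comm diff_neg_comm)
next
  fix x y z
  assume "x \<in> carrier (chang_group A)" "y \<in> carrier (chang_group A)" "z \<in> carrier (chang_group A)"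
  then show "x \<otimes>\<^bsub>chang_group A\<^esub> y \<otimes>\<^bsub>chang_group A\<^esub> z = x \<otimes>\<^bsub>chang_group A\<^esub> (y \<otimes>\<^bsub>chang_group A\<^esub> z)"
    using chang_add_assoc[of x y z] by (auto simp: chang_group_def)
next
  fix x assume "x \<in> carrier (chang_group A)"
  then obtain m a where x: "x = (m, a)" "a \<in> carrier A" "a \<noteq> mv_one A"
    by (auto simp: chang_group_def)
  \<comment> \<open>For a > 0 the inverse of m + a is (-m - 1) + (1 - a), whose fractional part is
    again in [0, 1).\<close>
  have "(if a = \<zero> then (- m, \<zero>) else (- m - 1, \<sim> a)) \<otimes>\<^bsub>chang_group A\<^esub> x = one (chang_group A)"
    using x assms by (auto simp: chang_group_def chang_add_def diff_self)
  moreover have "(if a = \<zero> then (- m, \<zero>) else (- m - 1, \<sim> a)) \<in> carrier (chang_group A)"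
    using x assms by (auto simp: chang_group_def)
  ultimately show "\<exists>y\<in>carrier (chang_group A). y \<otimes>\<^bsub>chang_group A\<^esub> x = one (chang_group A)"
    by blast
qed (use assms in \<open>auto simp: chang_group_def chang_add_def\<close>)

end

section \<open>Embedding torsion-free groups into the reals\<close>

text \<open>A relation instead of a function makes unions of chains immediate. Closure under
  quotients and the kernel condition together give both single-valuedness and injectivity.\<close>

definition partial_real_embedding :: "('a, 'b) monoid_scheme \<Rightarrow> 'a \<Rightarrow> ('a \<times> real) set \<Rightarrow> bool"
  where "partial_real_embedding G u R \<longleftrightarrow>
    R \<subseteq> carrier G \<times> UNIV \<and> (u, 1) \<in> R \<and>
    (\<forall>x r y s. (x, r) \<in> R \<and> (y, s) \<in> R \<longrightarrow> (x \<otimes>\<^bsub>G\<^esub> inv\<^bsub>G\<^esub> y, r - s) \<in> R) \<and>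
    (\<forall>x r. (x, r) \<in> R \<longrightarrow> (x = one G \<longleftrightarrow> r = 0))"

lemma partial_real_embeddingI:
  assumes "R \<subseteq> carrier G \<times> UNIV" "(u, 1) \<in> R"
    "\<And>x r. (x, r) \<in> R \<Longrightarrow> x = one G \<longleftrightarrow> r = 0"
    "\<And>x r y s. (x, r) \<in> R \<Longrightarrow> (y, s) \<in> R \<Longrightarrow> (x \<otimes>\<^bsub>G\<^esub> inv\<^bsub>G\<^esub> y, r - s) \<in> R"
  shows "partial_real_embedding G u R"
  using assms unfolding partial_real_embedding_def by blast

context comm_group
begin

lemma partial_real_embedding_mult:
  assumes "partial_real_embedding G u R"
  shows "(\<one>, 0) \<in> R"
    and "(x, r) \<in> R \<Longrightarrow> (inv x, - r) \<in> R"
    and "(x, r) \<in> R \<Longrightarrow> (y, s) \<in> R \<Longrightarrow> (x \<otimes> y, r + s) \<in> R"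
proof -
  have diff: "(x \<otimes> inv y, r - s) \<in> R" if "(x, r) \<in> R" "(y, s) \<in> R" for x r y s
    using assms that by (auto simp: partial_real_embedding_def)
  have cl: "x \<in> carrier G" if "(x, r) \<in> R" for x r
    using assms that by (auto simp: partial_real_embedding_def)
  have "(u, 1) \<in> R"
    using assms by (auto simp: partial_real_embedding_def)
  then show one: "(\<one>, 0) \<in> R"
    using diff[of u 1 u 1] cl by simp
  show inv: "(inv x, - r) \<in> R" if "(x, r) \<in> R" for x r
    using diff[OF one that] cl[OF that] by simp
  show "(x \<otimes> y, r + s) \<in> R" if "(x, r) \<in> R" "(y, s) \<in> R"
    using diff[OF that(1) inv[OF that(2)]] cl that by simp
qed

lemma partial_real_embedding_pow:
  assumes "partial_real_embedding G u R" "(x, r) \<in> R"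
  shows "(x [^] (k::int), of_int k * r) \<in> R"
proof -
  note mult = partial_real_embedding_mult[OF assms(1)]
  have x: "x \<in> carrier G"
    using assms by (auto simp: partial_real_embedding_def)
  show ?thesis
  proof (induction k rule: int_induct[where k = 0])
    case base
    then show ?case using mult(1) by simp
  next
    case (step1 i)
    then show ?case
      using mult(3)[OF step1(2) assms(2)] x by (simp add: int_pow_mult distrib_right)
  next
    case (step2 i)
    then show ?case
      using mult(3)[OF step2(2) mult(2)[OF assms(2)]] x int_pow_diff[of x i 1] by (simp add: left_diff_distrib)
  qed
qed

text \<open>A new element with a power in the domain is mapped to the quotient that this forces; any
  other one is mapped to a real number outside the divisible hull of the range.\<close>

lemma partial_real_embedding_extend:
  assumes "countable (carrier G)"
    and torsion_free: "\<And>x k. x \<in> carrier G \<Longrightarrow> k \<noteq> 0 \<Longrightarrow> x [^] (k::int) = \<one> \<Longrightarrow> x = \<one>"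
    and R: "partial_real_embedding G u R"
    and g: "g \<in> carrier G"
  obtains R' \<rho> where "partial_real_embedding G u R'" "R \<subseteq> R'" "(g, \<rho>) \<in> R'"
proof -
  note mult = partial_real_embedding_mult[OF R] and pow = partial_real_embedding_pow[OF R]
  have cl: "x \<in> carrier G" if "(x, r) \<in> R" for x r
    using R that by (auto simp: partial_real_embedding_def)
  have zero: "x = \<one> \<longleftrightarrow> r = 0" if "(x, r) \<in> R" for x r
    using R that by (auto simp: partial_real_embedding_def)
  \<comment> \<open>This equivalence makes the map sending \<open>x \<otimes> g [^] k\<close> to r +
    k * \<rho> well defined with trivial kernel.\<close>
  have "\<exists>\<rho>. \<forall>x r k. (x, r) \<in> R \<longrightarrow> (x \<otimes> g [^] (k::int) = \<one> \<longleftrightarrow> r + of_int k * \<rho> = 0)"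
  proof (cases "\<exists>n t. n \<noteq> 0 \<and> (g [^] (n::int), t) \<in> R")
    case True
    then obtain n :: int and t where n: "n \<noteq> 0" and t: "(g [^] n, t) \<in> R"
      by blast
    have "x \<otimes> g [^] k = \<one> \<longleftrightarrow> r + of_int k * (t / of_int n) = 0" if "(x, r) \<in> R" for x r and k :: int
    proof -
      have x: "x \<in> carrier G"
        using cl that .
      have "(x \<otimes> g [^] k) [^] n = x [^] n \<otimes> (g [^] n) [^] k"
        using x g by (simp add: int_pow_distrib int_pow_pow mult.commute)
      moreover have "(x [^] n \<otimes> (g [^] n) [^] k, of_int n * r + of_int k * t) \<in> R"
        using mult pow that t by blast
      moreover have "x \<otimes> g [^] k = \<one> \<longleftrightarrow> (x \<otimes> g [^] k) [^] n = \<one>"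
        using torsion_free[of "x \<otimes> g [^] k" n] n x g by auto
      ultimately have "x \<otimes> g [^] k = \<one> \<longleftrightarrow> of_int n * r + of_int k * t = 0"
        using zero by metis
      then show ?thesis
        using n by (simp add: field_simps)
    qed
    then show ?thesis by blast
  next
    case False
    \<comment> \<open>\<open>R\<close> is single-valued, hence countable like its domain, so only
      countably many values of \<rho> are excluded.\<close>
    have "inj_on fst R"
    proof (rule inj_onI)
      fix p q assume "p \<in> R" "q \<in> R" "fst p = fst q"
      then obtain x r s where "p = (x, r)" "q = (x, s)" "(x, r) \<in> R" "(x, s) \<in> R"
        by (metis prod.collapse)
      then show "p = q"
        using zero[of "x \<otimes> inv x" "r - s"] mult(3)[of x r "inv x" "- s"] mult(2)[of x s] cl[of x r] by auto
    qed
    moreover have "countable (fst ` R)"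
      using assms(1) by (rule countable_subset[rotated]) (auto dest: cl)
    ultimately have "countable R"
      using countable_image_inj_on by blast
    then have "countable ((\<lambda>((x, r), k). - r / of_int k) ` (R \<times> (UNIV :: int set)))"
      by auto
    then obtain \<rho> :: real where \<rho>: "\<rho> \<notin> (\<lambda>((x, r), k). - r / of_int k) ` (R \<times> (UNIV :: int set))"
      using uncountable_UNIV_real by (metis UNIV_eq_I)
    have "x \<otimes> g [^] k = \<one> \<longleftrightarrow> r + of_int k * \<rho> = 0" if xr: "(x, r) \<in> R" for x r and k :: int
    proof (cases "k = 0")
      case True
      then show ?thesis using zero xr cl by simp
    next
      case k: False
      have "x \<otimes> g [^] k \<noteq> \<one>"
      proof
        assume "x \<otimes> g [^] k = \<one>"
        then have "g [^] k = inv x"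
          using cl[OF xr] g by (metis inv_equality int_pow_closed m_comm)
        then show False
          using mult(2)[OF xr] False k by metis
      qed
      moreover have "\<rho> \<noteq> - r / of_int k"
        using \<rho> xr by (auto simp: image_iff)
      then have "r + of_int k * \<rho> \<noteq> 0"
        using k by (auto simp: field_simps)
      ultimately show ?thesis by simp
    qed
    then show ?thesis by blast
  qed
  then obtain \<rho> where
    \<rho>: "\<And>x r k. (x, r) \<in> R \<Longrightarrow> x \<otimes> g [^] (k::int) = \<one> \<longleftrightarrow> r + of_int k * \<rho> = 0"
    by blast
  define R' where "R' = {(x \<otimes> g [^] k, r + of_int k * \<rho>) |x r (k::int). (x, r) \<in> R}"
  have R'I: "(x \<otimes> g [^] k, r + of_int k * \<rho>) \<in> R'" if "(x, r) \<in> R" for x r and k :: int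
    unfolding R'_def using that by blast
  have sub: "R \<subseteq> R'"
  proof
    fix p assume "p \<in> R"
    then show "p \<in> R'"
      using R'I[of "fst p" "snd p" 0] cl[of "fst p" "snd p"] by simp
  qed
  have "partial_real_embedding G u R'"
  proof (rule partial_real_embeddingI)
    show "R' \<subseteq> carrier G \<times> UNIV"
      using cl g by (auto simp: R'_def)
    show "(u, 1) \<in> R'"
      using R sub by (auto simp: partial_real_embedding_def)
    fix x r assume xr: "(x, r) \<in> R'"
    then obtain x1 r1 k where 1: "(x1, r1) \<in> R" "x = x1 \<otimes> g [^] (k::int)" "r = r1 + of_int k * \<rho>"
      by (auto simp: R'_def)
    then show "x = \<one> \<longleftrightarrow> r = 0"
      using \<rho>[OF 1(1)] by simp
    fix y s assume "(y, s) \<in> R'"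
    then obtain y1 s1 l where 2: "(y1, s1) \<in> R" "y = y1 \<otimes> g [^] (l::int)" "s = s1 + of_int l * \<rho>"
      by (auto simp: R'_def)
    have "x \<otimes> inv y = (x1 \<otimes> inv y1) \<otimes> g [^] (k - l)"
      using 1 2 cl[OF 1(1)] cl[OF 2(1)] g by (simp add: int_pow_diff inv_mult m_ac)
    moreover have "r - s = (r1 + - s1) + of_int (k - l) * \<rho>"
      using 1 2 by (simp add: algebra_simps)
    moreover have "(x1 \<otimes> inv y1, r1 + - s1) \<in> R"
      using mult 1 2 by blast
    ultimately show "(x \<otimes> inv y, r - s) \<in> R'"
      using R'I by metis
  qed
  moreover have "(g, \<rho>) \<in> R'"
    using R'I[OF mult(1), of 1] g by simp
  ultimately show thesis
    using that sub by blast
qed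

text \<open>Zorn's lemma yields a maximal partial embedding, and extendability by any element makes
  its domain the whole group.\<close>

lemma countable_torsion_free_embeds_real:
  assumes "countable (carrier G)"
    and "\<And>x k. x \<in> carrier G \<Longrightarrow> k \<noteq> 0 \<Longrightarrow> x [^] (k::int) = \<one> \<Longrightarrow> x = \<one>"
    and u: "u \<in> carrier G" "u \<noteq> \<one>"
  obtains f :: "'a \<Rightarrow> real" where
    "\<And>x y. x \<in> carrier G \<Longrightarrow> y \<in> carrier G \<Longrightarrow> f (x \<otimes> y) = f x + f y"
    "inj_on f (carrier G)" "f u = 1"
proof -
  let ?P = "Collect (partial_real_embedding G u)"
  have "\<exists>M\<in>?P. \<forall>X\<in>?P. M \<subseteq> X \<longrightarrow> X = M"
  proof (rule subset_Zorn_nonempty)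
    \<comment> \<open>The powers of \<open>u\<close> go to the integers; the kernel is trivial
      because \<open>u\<close> has infinite order.\<close>
    have "partial_real_embedding G u (range (\<lambda>k::int. (u [^] k, of_int k)))"
    proof (rule partial_real_embeddingI)
      show "(u, 1) \<in> range (\<lambda>k::int. (u [^] k, of_int k))"
        using u by (intro range_eqI[of _ _ 1]) simp
      fix x r assume xr: "(x, r) \<in> range (\<lambda>k::int. (u [^] k, real_of_int k))"
      then obtain k :: int where k: "x = u [^] k" "r = of_int k"
        by blast
      show "x = \<one> \<longleftrightarrow> r = 0"
        using k u assms(2)[of u k] by auto
      fix y s assume ys: "(y, s) \<in> range (\<lambda>k::int. (u [^] k, real_of_int k))"
      then obtain l :: int where l: "y = u [^] l" "s = of_int l"
        by blast
      show "(x \<otimes> inv y, r - s) \<in> range (\<lambda>k::int. (u [^] k, real_of_int k))"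
        using k l u by (intro range_eqI[of _ _ "k - l"]) (simp add: int_pow_diff)
    qed (use u in auto)
    then show "?P \<noteq> {}"
      by blast
    fix C assume C: "C \<noteq> {}" "subset.chain ?P C"
    then have P: "partial_real_embedding G u R" if "R \<in> C" for R
      using that by (auto simp: subset.chain_def)
    have "partial_real_embedding G u (\<Union> C)"
    proof (rule partial_real_embeddingI)
      show "\<Union> C \<subseteq> carrier G \<times> UNIV"
        using P unfolding partial_real_embedding_def by blast
      show "(u, 1) \<in> \<Union> C"
        using P C(1) unfolding partial_real_embedding_def by blast
      fix x r assume "(x, r) \<in> \<Union> C"
      then obtain R where R: "R \<in> C" "(x, r) \<in> R" by blast
      then show "x = \<one> \<longleftrightarrow> r = 0"
        using P unfolding partial_real_embedding_def by blast
      fix y s assume "(y, s) \<in> \<Union> C"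
      then obtain S where S: "S \<in> C" "(y, s) \<in> S" by blast
      have "R \<subseteq> S \<or> S \<subseteq> R"
        using C R S by (auto simp: subset.chain_def)
      then obtain T where "T \<in> C" "(x, r) \<in> T" "(y, s) \<in> T"
        using R S by blast
      then show "(x \<otimes> inv y, r - s) \<in> \<Union> C"
        using P unfolding partial_real_embedding_def by blast
    qed
    then show "\<Union> C \<in> ?P" by simp
  qed
  then obtain R where R: "partial_real_embedding G u R"
    and max: "\<And>X. partial_real_embedding G u X \<Longrightarrow> R \<subseteq> X \<Longrightarrow> X = R"
    by blast
  note mult = partial_real_embedding_mult[OF R]
  have zero: "x = \<one> \<longleftrightarrow> r = 0" if "(x, r) \<in> R" for x r
    using R that by (auto simp: partial_real_embedding_def)
  have cl: "x \<in> carrier G" if "(x, r) \<in> R" for x r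
    using R that by (auto simp: partial_real_embedding_def)
  have "\<exists>r. (g, r) \<in> R" if g: "g \<in> carrier G" for g
  proof -
    obtain R' \<rho> where "partial_real_embedding G u R'" "R \<subseteq> R'" "(g, \<rho>) \<in> R'"
      by (rule partial_real_embedding_extend[OF assms(1) _ R g]) (blast intro: assms(2))+
    then show ?thesis
      using max by blast
  qed
  then obtain f where f: "\<And>g. g \<in> carrier G \<Longrightarrow> (g, f g) \<in> R"
    by metis
  have eq: "x = y \<longleftrightarrow> r = s" if "(x, r) \<in> R" "(y, s) \<in> R" for x y r s
  proof -
    have "(x \<otimes> inv y, r - s) \<in> R"
      using mult(3)[OF that(1) mult(2)[OF that(2)]] by simp
    moreover have "x \<otimes> inv y = \<one> \<longleftrightarrow> x = y"
      using cl that by (metis inv_solve_right' l_one one_closed r_inv)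
    ultimately show ?thesis
      using zero by auto
  qed
  show thesis
  proof
    show "f (x \<otimes> y) = f x + f y" if "x \<in> carrier G" "y \<in> carrier G" for x y
      using eq[OF f mult(3)[OF f f], of "x \<otimes> y" x y] that by simp
    show "inj_on f (carrier G)"
      using eq[OF f f] by (auto intro: inj_onI)
    show "f u = 1"
      using eq[OF f, of u u 1] R u by (auto simp: partial_real_embedding_def)
  qed
qed

end

section \<open>Back and forth between two regularly dense orders\<close>

text \<open>The segment from \<open>0\<close> to \<open>1\<close> of an additive subgroup \<open>H\<close> of the reals that is
  ordered, not necessarily as usual, by the cone \<open>P\<close> of strictly positive elements.\<close>

definition mv_segment :: "real set \<Rightarrow> real set \<Rightarrow> real mv_struct"
  where "mv_segment H P =
    \<lparr>carrier = {x \<in> H. - x \<notin> P \<and> x - 1 \<notin> P},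
     mv_plus = (\<lambda>x y. if x + y - 1 \<in> P then 1 else x + y), mv_neg = (\<lambda>x. 1 - x), mv_zero = 0\<rparr>"

locale unit_subgroup =
  fixes H :: "real set"
  assumes one_mem: "1 \<in> H"
    and diff_mem: "x \<in> H \<Longrightarrow> y \<in> H \<Longrightarrow> x - y \<in> H"
begin

lemma zero_mem: "0 \<in> H"
  using diff_mem[OF one_mem one_mem] by simp

lemma uminus_mem: "x \<in> H \<Longrightarrow> - x \<in> H"
  using diff_mem[OF zero_mem] by fastforce

lemma add_mem: "x \<in> H \<Longrightarrow> y \<in> H \<Longrightarrow> x + y \<in> H"
  using diff_mem[OF _ uminus_mem] by fastforce

lemma of_nat_mult_mem: "x \<in> H \<Longrightarrow> of_nat n * x \<in> H"
  by (induction n) (auto simp: zero_mem add_mem distrib_right)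

lemma of_int_mult_mem: "x \<in> H \<Longrightarrow> of_int k * x \<in> H"
  by (cases k rule: int_cases2) (use of_nat_mult_mem uminus_mem in force)+

lemma of_int_mem: "of_int k \<in> H"
  using of_int_mult_mem[OF one_mem] by simp

lemma sum_mem: "(\<And>i. i \<in> I \<Longrightarrow> f i \<in> H) \<Longrightarrow> sum f I \<in> H"
  by (induction I rule: infinite_finite_induct) (auto simp: zero_mem add_mem)

lemmas mem_intros = one_mem zero_mem diff_mem uminus_mem add_mem of_nat_mult_mem of_int_mult_mem
  of_int_mem sum_mem

end

text \<open>The order is linear but need not be Archimedean, so infinitesimals are allowed. For
  \<open>n = 1\<close> the last condition is density.\<close>

locale regular_cone = unit_subgroup +
  fixes P :: "real set"
  assumes cone_sub: "P \<subseteq> H"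
    and zero_cone: "0 \<notin> P"
    and one_cone: "1 \<in> P"
    and add_cone: "x \<in> P \<Longrightarrow> y \<in> P \<Longrightarrow> x + y \<in> P"
    and total_cone: "x \<in> H \<Longrightarrow> x \<noteq> 0 \<Longrightarrow> x \<in> P \<or> - x \<in> P"
    and regular_cone: "x \<in> H \<Longrightarrow> y \<in> H \<Longrightarrow> y - x \<in> P \<Longrightarrow> n > 0 \<Longrightarrow>
      \<exists>g\<in>H. of_nat n * g - x \<in> P \<and> y - of_nat n * g \<in> P"
begin

lemma uminus_cone: "x \<in> P \<Longrightarrow> - x \<notin> P"
  using add_cone[of x "- x"] zero_cone by auto

lemma of_nat_mult_cone: "x \<in> P \<Longrightarrow> n > 0 \<Longrightarrow> of_nat n * x \<in> P"
proof (induction n)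
  case (Suc n)
  then show ?case
    by (cases "n = 0") (auto simp: distrib_right intro: add_cone)
qed simp

text \<open>In a linearly ordered group a positive multiple has the sign of the element itself. This
  allows coefficients to be scaled to a common multiple.\<close>

lemma of_nat_mult_cone_iff:
  assumes "x \<in> H" "n > 0"
  shows "of_nat n * x \<in> P \<longleftrightarrow> x \<in> P"
proof
  assume *: "of_nat n * x \<in> P"
  show "x \<in> P"
  proof (rule ccontr)
    assume "x \<notin> P"
    then have "x = 0 \<or> - x \<in> P"
      using total_cone assms by blast
    then show False
      using * zero_cone of_nat_mult_cone[of "- x" n] uminus_cone assms by fastforce
  qed
qed (use assms of_nat_mult_cone in simp)

lemma of_int_mult_cone_iff:
  assumes "x \<in> P"
  shows "of_int k * x \<in> P \<longleftrightarrow> k > 0"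
proof (cases k rule: int_cases3)
  case (neg n)
  then show ?thesis
    using uminus_cone[OF of_nat_mult_cone[OF assms, of n]] by simp
qed (use assms zero_cone of_nat_mult_cone in auto)

lemma finite_cone_max:
  assumes "finite S" "S \<noteq> {}" "S \<subseteq> H"
  obtains m where "m \<in> S" "\<And>x. x \<in> S \<Longrightarrow> x = m \<or> m - x \<in> P"
proof -
  have "\<exists>m\<in>S. \<forall>x\<in>S. x = m \<or> m - x \<in> P"
    using assms
  proof (induction S rule: finite_ne_induct)
    case (insert z S)
    then obtain m where m: "m \<in> S" "\<forall>x\<in>S. x = m \<or> m - x \<in> P"
      by auto
    show ?case
    proof (cases "z - m \<in> P")
      case True
      have "z - x \<in> P" if "x \<in> S" for x
        using m that True add_cone[of "z - m" "m - x"] by auto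
      then show ?thesis by blast
    next
      case False
      then have "z = m \<or> m - z \<in> P"
        using total_cone[of "z - m"] diff_mem m insert.prems by auto
      then show ?thesis using m by blast
    qed
  qed simp
  then show thesis using that by blast
qed

lemma finite_cone_min:
  assumes "finite S" "S \<noteq> {}" "S \<subseteq> H"
  obtains m where "m \<in> S" "\<And>x. x \<in> S \<Longrightarrow> x = m \<or> x - m \<in> P"
proof -
  have "uminus ` S \<subseteq> H"
    using assms uminus_mem by auto
  then obtain m where "m \<in> uminus ` S" "\<And>x. x \<in> uminus ` S \<Longrightarrow> x = m \<or> m - x \<in> P"
    using finite_cone_max[of "uminus ` S"] assms by blast
  then show thesis
    using that[of "- m"] by force
qed

end

text \<open>Pairs of values of the same affine integer combination, with coefficients at most \<open>N\<close>, in
  the two environments.\<close>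

definition combs :: "nat \<Rightarrow> nat \<Rightarrow> (nat \<Rightarrow> real) \<Rightarrow> (nat \<Rightarrow> real) \<Rightarrow> (real \<times> real) set"
  where "combs n N d e =
    {((\<Sum>j<n. of_int (c j) * d j) + of_int k, (\<Sum>j<n. of_int (c j) * e j) + of_int k) |c k.
      (\<forall>j<n. \<bar>c j\<bar> \<le> int N) \<and> \<bar>k\<bar> \<le> int N}"

lemma combsI:
  "(\<And>j. j < n \<Longrightarrow> \<bar>c j\<bar> \<le> int N) \<Longrightarrow> \<bar>k\<bar> \<le> int N \<Longrightarrow>
    x = (\<Sum>j<n. of_int (c j) * d j) + of_int k \<Longrightarrow> y = (\<Sum>j<n. of_int (c j) * e j) + of_int k \<Longrightarrow>
    (x, y) \<in> combs n N d e"
  unfolding combs_def by (rule CollectI, rule exI[of _ c], rule exI[of _ k]) simp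

lemma combsE:
  assumes "(x, y) \<in> combs n N d e"
  obtains c k where "\<And>j. j < n \<Longrightarrow> \<bar>c j\<bar> \<le> int N" "\<bar>k\<bar> \<le> int N"
    "x = (\<Sum>j<n. of_int (c j) * d j) + of_int k" "y = (\<Sum>j<n. of_int (c j) * e j) + of_int k"
  using assms unfolding combs_def mem_Collect_eq
  apply (elim exE conjE Pair_inject)
  subgoal for c k
    by (rule that[of c k]) simp_all
  done

lemma finite_combs: "finite (combs n N d e)"
proof -
  let ?C = "({..<n} \<rightarrow>\<^sub>E {- int N..int N}) \<times> {- int N..int N}"
  let ?f = "\<lambda>(c, k). ((\<Sum>j<n. of_int (c j) * d j) + real_of_int k, (\<Sum>j<n. of_int (c j) * e j) + real_of_int k)"
  have "combs n N d e \<subseteq> ?f ` ?C"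
  proof
    fix p assume "p \<in> combs n N d e"
    then obtain c k where ck: "\<And>j. j < n \<Longrightarrow> \<bar>c j\<bar> \<le> int N" "\<bar>k\<bar> \<le> int N"
      "p = ((\<Sum>j<n. of_int (c j) * d j) + of_int k, (\<Sum>j<n. of_int (c j) * e j) + of_int k)"
      unfolding combs_def by blast
    have "p = ?f (restrict c {..<n}, k)"
      using ck(3) by simp
    moreover have "(restrict c {..<n}, k) \<in> ?C"
    proof -
      have "c j \<in> {- int N..int N}" if "j < n" for j
        using ck(1)[OF that] by auto
      moreover have "k \<in> {- int N..int N}"
        using ck(2) by auto
      ultimately show ?thesis by auto
    qed
    ultimately show "p \<in> ?f ` ?C" by blast
  qed
  then show ?thesis
    by (rule finite_subset) (intro finite_imageI finite_cartesian_product finite_PiE; simp)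
qed

lemma combs_of_int: "\<bar>k\<bar> \<le> int N \<Longrightarrow> (of_int k, of_int k) \<in> combs n N d e"
  by (rule combsI[of _ "\<lambda>_. 0"]) auto

lemma combs_var:
  assumes "i < n" "N \<ge> 1"
  shows "(d i, e i) \<in> combs n N d e"
proof (rule combsI[of _ "\<lambda>j. if j = i then 1 else 0" _ 0])
  show "d i = (\<Sum>j<n. of_int (if j = i then 1 else 0) * d j) + of_int 0" for d :: "nat \<Rightarrow> real"
  proof -
    have "(\<Sum>j<n. of_int (if j = i then 1 else 0) * d j) = (\<Sum>j<n. if j = i then d j else 0)"
      by (rule sum.cong) auto
    then show ?thesis using assms by simp
  qed
  then show "e i = (\<Sum>j<n. of_int (if j = i then 1 else 0) * e j) + of_int 0" .
qed (use assms in auto)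

lemma combs_mono:
  assumes "p \<in> combs n N d e" "N \<le> N'"
  shows "p \<in> combs n N' d e"
proof -
  obtain x y where p: "p = (x, y)"
    by fastforce
  obtain c k where ck: "\<And>j. j < n \<Longrightarrow> \<bar>c j\<bar> \<le> int N" "\<bar>k\<bar> \<le> int N"
    "x = (\<Sum>j<n. of_int (c j) * d j) + of_int k" "y = (\<Sum>j<n. of_int (c j) * e j) + of_int k"
    by (rule combsE[OF assms(1)[unfolded p]]) (rule that; assumption)
  have "\<bar>c j\<bar> \<le> int N'" if "j < n" for j
    using ck(1)[OF that] assms(2) by linarith
  then show ?thesis
    unfolding p using ck(2,3,4) assms(2) by (intro combsI[of n c N' k]) auto
qed

lemma combs_add:
  assumes "(x, y) \<in> combs n N d e" "(x', y') \<in> combs n N' d e"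
  shows "(x + x', y + y') \<in> combs n (N + N') d e"
proof -
  obtain c k where ck: "\<And>j. j < n \<Longrightarrow> \<bar>c j\<bar> \<le> int N" "\<bar>k\<bar> \<le> int N"
    "x = (\<Sum>j<n. of_int (c j) * d j) + of_int k" "y = (\<Sum>j<n. of_int (c j) * e j) + of_int k"
    by (rule combsE[OF assms(1)]) (rule that; assumption)
  obtain c' k' where ck': "\<And>j. j < n \<Longrightarrow> \<bar>c' j\<bar> \<le> int N'" "\<bar>k'\<bar> \<le> int N'"
    "x' = (\<Sum>j<n. of_int (c' j) * d j) + of_int k'" "y' = (\<Sum>j<n. of_int (c' j) * e j) + of_int k'"
    by (rule combsE[OF assms(2)]) (rule that; assumption)
  show ?thesis
  proof (rule combsI[of _ "\<lambda>j. c j + c' j" _ "k + k'"])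
    show "\<bar>c j + c' j\<bar> \<le> int (N + N')" if "j < n" for j
      using ck(1)[OF that] ck'(1)[OF that] by linarith
  qed (use ck ck' in \<open>auto simp: sum.distrib distrib_right\<close>)
qed

lemma combs_scale:
  assumes "(x, y) \<in> combs n N d e" "\<bar>m\<bar> \<le> int M"
  shows "(of_int m * x, of_int m * y) \<in> combs n (M * N) d e"
proof -
  obtain c k where ck: "\<And>j. j < n \<Longrightarrow> \<bar>c j\<bar> \<le> int N" "\<bar>k\<bar> \<le> int N"
    "x = (\<Sum>j<n. of_int (c j) * d j) + of_int k" "y = (\<Sum>j<n. of_int (c j) * e j) + of_int k"
    by (rule combsE[OF assms(1)]) (rule that; assumption)
  have "\<bar>m * l\<bar> \<le> int (M * N)" if "\<bar>l\<bar> \<le> int N" for l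
    using that assms(2) by (simp add: abs_mult mult_mono)
  then show ?thesis
    using ck by (intro combsI[of _ "\<lambda>j. m * c j" _ "m * k"])
      (auto simp: distrib_left sum_distrib_left mult.assoc)
qed

lemma combs_uminus: "(x, y) \<in> combs n N d e \<Longrightarrow> (- x, - y) \<in> combs n N d e"
  using combs_scale[of x y n N d e "- 1" 1] by simp

lemma combs_diff:
  "(x, y) \<in> combs n N d e \<Longrightarrow> (x', y') \<in> combs n N' d e \<Longrightarrow> (x - x', y - y') \<in> combs n (N + N') d e"
  using combs_add[OF _ combs_uminus] by fastforce

lemma combs_swap: "(x, y) \<in> combs n N d e \<longleftrightarrow> (y, x) \<in> combs n N e d"
  unfolding combs_def by blast

lemma combs_upd:
  assumes "(x, y) \<in> combs n N (d(i := a)) (e(i := b))" "i < n"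
  obtains m x' y' where "\<bar>m\<bar> \<le> int N" "(x', y') \<in> combs n N d e"
    "x = of_int m * a + x'" "y = of_int m * b + y'"
proof -
  obtain c k where ck: "\<And>j. j < n \<Longrightarrow> \<bar>c j\<bar> \<le> int N" "\<bar>k\<bar> \<le> int N"
    "x = (\<Sum>j<n. of_int (c j) * (d(i := a)) j) + of_int k"
    "y = (\<Sum>j<n. of_int (c j) * (e(i := b)) j) + of_int k"
    by (rule combsE[OF assms(1)]) (rule that; assumption)
  have *: "(\<Sum>j<n. of_int (c j) * (d(i := a)) j) = of_int (c i) * a + (\<Sum>j<n. of_int ((c(i := 0)) j) * d j)"
    for d :: "nat \<Rightarrow> real" and a
  proof -
    have "(\<Sum>j\<in>{..<n} - {i}. of_int (c j) * (d(i := a)) j) = (\<Sum>j\<in>{..<n} - {i}. of_int ((c(i := 0)) j) * d j)"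
      by (rule sum.cong) auto
    then show ?thesis
      using assms(2) by (simp add: sum.remove[of "{..<n}" i])
  qed
  define X where "X d = (\<Sum>j<n. of_int ((c(i := 0)) j) * d j) + real_of_int k" for d :: "nat \<Rightarrow> real"
  show thesis
  proof (rule that[of "c i" "X d" "X e"])
    show "(X d, X e) \<in> combs n N d e"
      using ck(1,2) unfolding X_def by (intro combsI[of _ "c(i := 0)" _ k]) auto
    show "x = of_int (c i) * a + X d" "y = of_int (c i) * b + X e"
      unfolding ck(3,4) * X_def by simp_all
  qed (use ck assms in auto)
qed

text \<open>\<open>n\<close> bounds the variables, \<open>N\<close> the coefficients. Comparing
  signs suffices, since an element is 0 iff neither it nor its negative is positive. The congruence
  modulo \<open>M\<close> makes sense because both environments take values in the same
  \<open>H\<close>.\<close>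

definition back_forth ::
    "real set \<Rightarrow> nat \<Rightarrow> nat \<Rightarrow> nat \<Rightarrow> real set \<Rightarrow> real set \<Rightarrow> (nat \<Rightarrow> real) \<Rightarrow> (nat \<Rightarrow> real) \<Rightarrow> bool"
  where "back_forth H n N M P Q d e \<longleftrightarrow>
    range d \<subseteq> carrier (mv_segment H P) \<and> range e \<subseteq> carrier (mv_segment H Q) \<and>
    (\<forall>j. \<exists>h\<in>H. e j - d j = of_nat M * h) \<and>
    (\<forall>x y. (x, y) \<in> combs n N d e \<longrightarrow> (x \<in> P \<longleftrightarrow> y \<in> Q))"

lemma back_forthD:
  assumes "back_forth H n N M P Q d e"
  shows "d j \<in> carrier (mv_segment H P)" "e j \<in> carrier (mv_segment H Q)"
    "\<exists>h\<in>H. e j - d j = of_nat M * h"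
    "(x, y) \<in> combs n N d e \<Longrightarrow> x \<in> P \<longleftrightarrow> y \<in> Q"
proof -
  note * = assms[unfolded back_forth_def]
  show "d j \<in> carrier (mv_segment H P)"
    by (rule range_subsetD[OF *[THEN conjunct1]])
  show "e j \<in> carrier (mv_segment H Q)"
    by (rule range_subsetD[OF *[THEN conjunct2, THEN conjunct1]])
  show "\<exists>h\<in>H. e j - d j = of_nat M * h"
    by (rule *[THEN conjunct2, THEN conjunct2, THEN conjunct1, rule_format])
  show "(x, y) \<in> combs n N d e \<Longrightarrow> x \<in> P \<longleftrightarrow> y \<in> Q"
    by (rule *[THEN conjunct2, THEN conjunct2, THEN conjunct2, rule_format])
qed

lemma back_forthI:
  assumes "\<And>j. d j \<in> carrier (mv_segment H P)" "\<And>j. e j \<in> carrier (mv_segment H Q)"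
    "\<And>j. \<exists>h\<in>H. e j - d j = of_nat M * h"
    "\<And>x y. (x, y) \<in> combs n N d e \<Longrightarrow> x \<in> P \<longleftrightarrow> y \<in> Q"
  shows "back_forth H n N M P Q d e"
  unfolding back_forth_def by (intro conjI allI impI image_subsetI assms)

context unit_subgroup
begin

lemma back_forth_sym:
  assumes "back_forth H n N M P Q d e"
  shows "back_forth H n N M Q P e d"
proof (rule back_forthI)
  fix j
  obtain h where "h \<in> H" "e j - d j = of_nat M * h"
    using back_forthD(3)[OF assms] by blast
  then show "\<exists>h\<in>H. d j - e j = of_nat M * h"
    by (intro bexI[of _ "- h"]) (auto simp: uminus_mem)
next
  fix x y assume "(x, y) \<in> combs n N e d"
  then have "(y, x) \<in> combs n N d e"
    by (rule combs_swap[THEN iffD1])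
  then have "y \<in> P \<longleftrightarrow> x \<in> Q"
    by (rule back_forthD(4)[OF assms])
  then show "x \<in> Q \<longleftrightarrow> y \<in> P"
    by (rule sym)
qed (rule back_forthD[OF assms])+

lemma back_forth_mono:
  assumes "back_forth H n N M P Q d e" "N' \<le> N" "M' dvd M"
  shows "back_forth H n N' M' P Q d e"
proof (rule back_forthI)
  fix j
  obtain m where m: "M = M' * m"
    using assms(3) by (auto simp: dvd_def)
  obtain h where "h \<in> H" "e j - d j = of_nat M * h"
    using back_forthD(3)[OF assms(1)] by blast
  then show "\<exists>h\<in>H. e j - d j = of_nat M' * h"
    by (intro bexI[of _ "of_nat m * h"]) (auto simp: of_nat_mult_mem m)
next
  fix x y assume "(x, y) \<in> combs n N' d e"
  then show "x \<in> P \<longleftrightarrow> y \<in> Q"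
    by (rule back_forthD(4)[OF assms(1) combs_mono[OF _ assms(2)]])
qed (rule back_forthD[OF assms(1)])+

text \<open>Integer constants cancel in \<open>y - x\<close>, so the congruence passes to all
  integer combinations, whatever the bound \<open>N'\<close>.\<close>

lemma back_forth_combs_mem:
  assumes "back_forth H n N M P Q d e" "(x, y) \<in> combs n N' d e"
  shows "x \<in> H" "y \<in> H" "\<exists>h\<in>H. y - x = of_nat M * h"
proof -
  have de: "d j \<in> H" "e j \<in> H" for j
  proof -
    have "d j \<in> carrier (mv_segment H P)" "e j \<in> carrier (mv_segment H Q)"
      by (rule back_forthD[OF assms(1)])+
    then show "d j \<in> H" "e j \<in> H"
      by (simp_all add: mv_segment_def)
  qed
  obtain c k where ck: "x = (\<Sum>j<n. of_int (c j) * d j) + of_int k" "y = (\<Sum>j<n. of_int (c j) * e j) + of_int k"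
    by (rule combsE[OF assms(2)]) (rule that; assumption)
  show "x \<in> H" "y \<in> H"
    using de by (auto simp: ck intro!: mem_intros)
  obtain h where h: "\<And>j. h j \<in> H" "\<And>j. e j - d j = of_nat M * h j"
    using back_forthD(3)[OF assms(1)] by metis
  have "y - x = (\<Sum>j<n. of_int (c j) * (e j - d j))"
    by (simp add: ck sum_subtractf right_diff_distrib)
  also have "\<dots> = of_nat M * (\<Sum>j<n. of_int (c j) * h j)"
    by (simp add: h(2) sum_distrib_left mult_ac)
  finally show "\<exists>h\<in>H. y - x = of_nat M * h"
    using h(1) by (auto intro!: mem_intros)
qed

end

section \<open>One round of the back-and-forth game\<close>

locale two_regular_cones = P: regular_cone H P + Q: regular_cone H Q for H P Q
begin

text \<open>The conditions on the new element \<open>b\<close> fix its class modulo \<open>M\<close> and the position of \<open>K b\<close>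
  among the finitely many combinations with coefficients at most \<open>K N\<close>, where \<open>K\<close> is a common
  multiple of all the coefficients that \<open>b\<close> may get.\<close>

lemma back_forth_step:
  assumes bf: "back_forth H n (N * (fact N * N) + fact N * N) (fact N * M) P Q d e"
    and N: "N \<ge> 1" and M: "M \<ge> 1" and i: "i < n" and a: "a \<in> carrier (mv_segment H P)"
  obtains b where "b \<in> carrier (mv_segment H Q)" "back_forth H n N M P Q (d(i := a)) (e(i := b))"
proof -
  define K :: nat where "K = fact N"
  have K: "K > 0" "\<And>k. 1 \<le> k \<Longrightarrow> k \<le> N \<Longrightarrow> k dvd K"
    by (auto simp: K_def intro: dvd_fact)
  define W where "W = combs n (K * N) d e"
  note bf = bf[folded K_def]
  have agree: "x \<in> P \<longleftrightarrow> y \<in> Q" if "(x, y) \<in> combs n L d e" "L \<le> N * (K * N) + K * N" for x y L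
    by (rule back_forthD(4)[OF bf combs_mono[OF that]])
  have mem: "x \<in> H" "y \<in> H" if "(x, y) \<in> combs n L d e" for x y L
    using P.back_forth_combs_mem[OF bf that] by auto
  have W_le: "K * N + K * N \<le> N * (K * N) + K * N"
    using N by simp
  have aH: "a \<in> H" and a0: "- a \<notin> P" and a1: "a - 1 \<notin> P"
    using a by (auto simp: mv_segment_def)
  have "\<exists>b\<in>H. (\<exists>h\<in>H. b - a = of_nat M * h) \<and>
      (\<forall>x y m. (x, y) \<in> combs n N d e \<longrightarrow> \<bar>m\<bar> \<le> int N \<longrightarrow> (of_int m * a + x \<in> P \<longleftrightarrow> of_int m * b + y \<in> Q))"
  \<comment> \<open>If \<open>K * a\<close> is itself a combination, \<open>K * b\<close> must be
    the corresponding \<open>t\<close>. Since \<open>t\<close> and \<open>K * a\<close> are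
    congruent modulo \<open>K * M\<close>, such a \<open>b\<close> exists in \<open>H\<close> and is
    congruent to \<open>a\<close> modulo \<open>M\<close>.\<close>
  proof (cases "\<exists>s t. (s, t) \<in> W \<and> of_nat K * a = s")
    case True
    then obtain t where t: "(of_nat K * a, t) \<in> W"
      by blast
    then obtain h where h: "h \<in> H" "t - of_nat K * a = of_nat (K * M) * h"
      using P.back_forth_combs_mem(3)[OF bf] unfolding W_def by blast
    define b where "b = a + of_nat M * h"
    have bH: "b \<in> H"
      using aH h by (auto simp: b_def intro!: P.mem_intros)
    have Kb: "of_nat K * b = t"
      using h(2) by (simp add: b_def algebra_simps)
    have "of_int m * a + x \<in> P \<longleftrightarrow> of_int m * b + y \<in> Q"
      if xy: "(x, y) \<in> combs n N d e" and m: "\<bar>m\<bar> \<le> int N" for x y m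
    proof -
      \<comment> \<open>The bound \<open>N * (K * N) + K * N\<close> required of the old
        environments comes from this combination.\<close>
      have "(of_int m * (of_nat K * a) + of_int (int K) * x, of_int m * t + of_int (int K) * y)
          \<in> combs n (N * (K * N) + K * N) d e"
        using t m xy unfolding W_def by (intro combs_add combs_scale) auto
      then have "of_int m * (of_nat K * a) + of_nat K * x \<in> P \<longleftrightarrow> of_int m * t + of_nat K * y \<in> Q"
        using agree by fastforce
      moreover have "of_int m * (of_nat K * a) + of_nat K * x = of_nat K * (of_int m * a + x)"
        "of_int m * t + of_nat K * y = of_nat K * (of_int m * b + y)"
        by (simp_all add: Kb[symmetric] algebra_simps)
      ultimately show ?thesis
        using P.of_nat_mult_cone_iff[of "of_int m * a + x" K] Q.of_nat_mult_cone_iff[of "of_int m * b + y" K]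
          K mem[OF xy] aH bH by (simp add: P.mem_intros)
    qed
    then show ?thesis
      using bH h(1) by (intro bexI[of _ b]) (auto simp: b_def)
  next
    case False
    \<comment> \<open>\<open>Lo\<close> and \<open>Up\<close> are the cut that \<open>K * a\<close>
      makes in \<open>W\<close>, transported to the other order. The combinations 0 and
      \<open>K\<close> keep both parts nonempty.\<close>
    define Lo where "Lo = {t. \<exists>s. (s, t) \<in> W \<and> of_nat K * a - s \<in> P}"
    define Up where "Up = {t. \<exists>s. (s, t) \<in> W \<and> s - of_nat K * a \<in> P}"
    have KaH: "of_nat K * a \<in> H"
      using aH by (rule P.of_nat_mult_mem)
    have split: "of_nat K * a - s \<in> P \<or> s - of_nat K * a \<in> P" if "(s, t) \<in> W" for s t
      using P.total_cone[of "of_nat K * a - s"] that False mem KaH P.diff_mem unfolding W_def by fastforce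
    have fin: "finite Lo" "finite Up" and sub: "Lo \<subseteq> H" "Up \<subseteq> H"
    proof -
      have "Lo \<subseteq> snd ` W" "Up \<subseteq> snd ` W"
        by (force simp: Lo_def Up_def)+
      moreover have "finite (snd ` W)" "snd ` W \<subseteq> H"
        using mem unfolding W_def by (auto simp: finite_combs)
      ultimately show "finite Lo" "finite Up" "Lo \<subseteq> H" "Up \<subseteq> H"
        using finite_subset by blast+
    qed
    have zero_W: "(0, 0) \<in> W" and K_W: "(of_nat K, of_nat K) \<in> W"
      using combs_of_int[of 0 "K * N" n d e] combs_of_int[of "int K" "K * N" n d e] mult_le_mono2[OF N, of K]
      by (auto simp: W_def simp flip: of_nat_mult)
    have "0 - of_nat K * a \<notin> P"
      using P.of_nat_mult_cone_iff[of "- a" K] K a0 aH by (simp add: P.uminus_mem)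
    then have "of_nat K * a - 0 \<in> P"
      using split[OF zero_W] by blast
    then have "0 \<in> Lo"
      unfolding Lo_def using zero_W by blast
    then have Lo_ne: "Lo \<noteq> {}"
      by blast
    have "of_nat K * a - of_nat K \<notin> P"
      using P.of_nat_mult_cone_iff[of "a - 1" K] K a1 aH
      by (simp add: P.mem_intros right_diff_distrib)
    then have "of_nat K - of_nat K * a \<in> P"
      using split[OF K_W] by blast
    then have "of_nat K \<in> Up"
      unfolding Up_def using K_W by blast
    then have Up_ne: "Up \<noteq> {}"
      by blast
    obtain l where l: "l \<in> Lo" "\<And>t. t \<in> Lo \<Longrightarrow> t = l \<or> l - t \<in> Q"
      using Q.finite_cone_max fin(1) Lo_ne sub(1) by metis
    obtain u where u: "u \<in> Up" "\<And>t. t \<in> Up \<Longrightarrow> t = u \<or> t - u \<in> Q"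
      using Q.finite_cone_min fin(2) Up_ne sub(2) by metis
    have "u - l \<in> Q"
    proof -
      obtain s s' where s: "(s, u) \<in> W" "s - of_nat K * a \<in> P" "(s', l) \<in> W" "of_nat K * a - s' \<in> P"
        using l(1) u(1) unfolding Lo_def Up_def by blast
      then have "s - s' \<in> P"
        using P.add_cone[OF s(2,4)] by simp
      then show ?thesis
        using agree[OF combs_diff W_le] s(1,3) unfolding W_def by blast
    qed
    then have "(u - of_nat K * a) - (l - of_nat K * a) \<in> Q"
      by simp
    moreover have "l - of_nat K * a \<in> H" "u - of_nat K * a \<in> H"
      using l(1) u(1) sub KaH P.diff_mem by blast+
    \<comment> \<open>Regularity is applied to the interval from \<open>l\<close> to
      \<open>u\<close> shifted by \<open>- K * a\<close>. A multiple of \<open>K * M\<close> in it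
      gives \<open>b = a + M * g\<close>, congruent to \<open>a\<close> modulo \<open>M\<close>,
      with \<open>K * b\<close> between \<open>l\<close> and \<open>u\<close>.\<close>
    ultimately obtain g where g: "g \<in> H" "of_nat (K * M) * g - (l - of_nat K * a) \<in> Q"
      "(u - of_nat K * a) - of_nat (K * M) * g \<in> Q"
      using Q.regular_cone[of "l - of_nat K * a" "u - of_nat K * a" "K * M"] K(1) M by auto
    define b where "b = a + of_nat M * g"
    have bH: "b \<in> H"
      using aH g by (auto simp: b_def intro!: P.mem_intros)
    have b: "of_nat K * b - l \<in> Q" "u - of_nat K * b \<in> Q"
      using g(2,3) by (simp_all add: b_def algebra_simps)
    have lo: "of_nat K * b - t \<in> Q" if "t \<in> Lo" for t
      using l(2)[OF that] b(1) Q.add_cone[OF b(1), of "l - t"] by auto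
    have up: "t - of_nat K * b \<in> Q" if "t \<in> Up" for t
      using u(2)[OF that] b(2) Q.add_cone[OF b(2), of "t - u"] by auto
    have pos: "of_nat K * a - s \<in> P \<longleftrightarrow> of_nat K * b - t \<in> Q"
      and neg: "s - of_nat K * a \<in> P \<longleftrightarrow> t - of_nat K * b \<in> Q" if "(s, t) \<in> W" for s t
    proof -
      have "t \<in> Lo \<longleftrightarrow> of_nat K * a - s \<in> P" if "of_nat K * a - s \<in> P"
        using that \<open>(s, t) \<in> W\<close> unfolding Lo_def by blast
      moreover have "t \<in> Up" if "s - of_nat K * a \<in> P"
        using that \<open>(s, t) \<in> W\<close> unfolding Up_def by blast
      ultimately show "of_nat K * a - s \<in> P \<longleftrightarrow> of_nat K * b - t \<in> Q"
        "s - of_nat K * a \<in> P \<longleftrightarrow> t - of_nat K * b \<in> Q"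
        using split[OF that] lo[of t] up[of t] Q.uminus_cone[of "of_nat K * b - t"]
          P.uminus_cone[of "of_nat K * a - s"] by auto
    qed
    have "of_int m * a + x \<in> P \<longleftrightarrow> of_int m * b + y \<in> Q"
      if xy: "(x, y) \<in> combs n N d e" and m: "\<bar>m\<bar> \<le> int N" for x y m
    proof (cases "m = 0")
      case True
      have "N \<le> N * (K * N) + K * N"
        using K(1) by (simp add: trans_le_add2)
      then show ?thesis
        using agree[OF xy] True by simp
    next
      case m0: False
      define k where "k = nat \<bar>m\<bar>"
      have k: "1 \<le> k" "k \<le> N" "\<bar>m\<bar> = int k"
        using m m0 by (auto simp: k_def)
      \<comment> \<open>Multiplication by \<open>q\<close> turns the coefficient \<open>m\<close>
        into \<open>K\<close> or \<open>- K\<close>; the sign of \<open>m\<close> decides between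
        \<open>pos\<close> and \<open>neg\<close>.\<close>
      obtain q where q: "K = k * q"
        using K(2)[OF k(1,2)] by (auto simp: dvd_def)
      have q0: "q > 0"
        using K(1) q by simp
      have "q * N \<le> K * N"
        using k(1) q by simp
      then have W: "(of_nat q * x, of_nat q * y) \<in> W" "(- (of_nat q * x), - (of_nat q * y)) \<in> W"
        using combs_scale[OF xy, of "int q" q] combs_mono combs_uminus unfolding W_def by auto
      have "of_int m * a + x \<in> P \<longleftrightarrow> of_nat q * (of_int m * a + x) \<in> P"
        "of_int m * b + y \<in> Q \<longleftrightarrow> of_nat q * (of_int m * b + y) \<in> Q"
        using P.of_nat_mult_cone_iff[of "of_int m * a + x" q] Q.of_nat_mult_cone_iff[of "of_int m * b + y" q]
          q0 mem[OF xy] aH bH by (simp_all add: P.mem_intros)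
      moreover have "of_nat q * (of_int m * a + x) \<in> P \<longleftrightarrow> of_nat q * (of_int m * b + y) \<in> Q"
      proof (cases "m > 0")
        case True
        then have "m = int k" using k by simp
        then show ?thesis
          using pos[OF W(2)] by (simp add: q algebra_simps)
      next
        case False
        then have "m = - int k" using k by simp
        then show ?thesis
          using neg[OF W(1)] by (simp add: q algebra_simps)
      qed
      ultimately show ?thesis by simp
    qed
    then show ?thesis
      using bH g(1) by (intro bexI[of _ b]) (auto simp: b_def)
  qed
  then obtain b where b: "b \<in> H" "\<exists>h\<in>H. b - a = of_nat M * h"
    "\<And>x y m. (x, y) \<in> combs n N d e \<Longrightarrow> \<bar>m\<bar> \<le> int N \<Longrightarrow> of_int m * a + x \<in> P \<longleftrightarrow> of_int m * b + y \<in> Q"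
    by blast
  have "- b \<notin> Q"
    using b(3)[OF combs_of_int[of 0 N n d e], of "- 1"] N a0 by simp
  moreover have "b - 1 \<notin> Q"
    using b(3)[OF combs_of_int[of "- 1" N n d e], of 1] N a1 by simp
  ultimately have bc: "b \<in> carrier (mv_segment H Q)"
    using b(1) by (simp add: mv_segment_def)
  have "back_forth H n N M P Q d e"
    by (rule P.back_forth_mono[OF bf]) (use K(1) in \<open>auto simp: trans_le_add2\<close>)
  then have "back_forth H n N M P Q (d(i := a)) (e(i := b))"
  proof (intro back_forthI)
    fix x y assume "(x, y) \<in> combs n N (d(i := a)) (e(i := b))"
    then obtain m x' y' where "\<bar>m\<bar> \<le> int N" "(x', y') \<in> combs n N d e"
      "x = of_int m * a + x'" "y = of_int m * b + y'"
      by (rule combs_upd[OF _ i])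
    then show "x \<in> P \<longleftrightarrow> y \<in> Q"
      using b(3) by simp
  qed (use a bc b(2) back_forthD[OF \<open>back_forth H n N M P Q d e\<close>] in auto)
  with bc show thesis by (rule that)
qed

text \<open>The only case distinction in evaluating a term is the truncation of a sum, decided by
  the sign of x + y - 1. Both sides decide it alike, so they arrive at the same affine combination.
  The extra 1 in the bound for \<open>Plus\<close> serves this test.\<close>

lemma back_forth_term:
  assumes "term_vars t \<subseteq> {..<n}"
  shows "\<exists>N\<ge>1. \<forall>M d e. back_forth H n N M P Q d e \<longrightarrow>
    (term_val (mv_segment H P) d t, term_val (mv_segment H Q) e t) \<in> combs n N d e"
  using assms
proof (induction t)
  case (Var i)
  then show ?case
    by (intro exI[of _ 1]) (auto simp: combs_var)
next
  case Zero
  show ?case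
    using combs_of_int[of 0 1 n] by (intro exI[of _ 1]) (auto simp: mv_segment_def)
next
  case (Plus s t)
  then obtain N1 N2 where
    1: "N1 \<ge> 1" "\<And>M d e. back_forth H n N1 M P Q d e \<Longrightarrow>
      (term_val (mv_segment H P) d s, term_val (mv_segment H Q) e s) \<in> combs n N1 d e" and
    2: "N2 \<ge> 1" "\<And>M d e. back_forth H n N2 M P Q d e \<Longrightarrow>
      (term_val (mv_segment H P) d t, term_val (mv_segment H Q) e t) \<in> combs n N2 d e"
    by auto
  show ?case
  proof (intro exI[of _ "N1 + N2 + 1"] conjI allI impI)
    fix M d e assume bf: "back_forth H n (N1 + N2 + 1) M P Q d e"
    let ?x = "term_val (mv_segment H P) d s + term_val (mv_segment H P) d t"
    let ?y = "term_val (mv_segment H Q) e s + term_val (mv_segment H Q) e t"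
    have xy: "(?x, ?y) \<in> combs n (N1 + N2) d e"
      by (rule combs_add[OF 1(2) 2(2)]; rule P.back_forth_mono[OF bf]) auto
    then have "(?x - 1, ?y - 1) \<in> combs n (N1 + N2 + 1) d e"
      using combs_diff[OF _ combs_of_int[of 1 1 n d e]] by fastforce
    then have "?x - 1 \<in> P \<longleftrightarrow> ?y - 1 \<in> Q"
      by (rule back_forthD(4)[OF bf])
    then show "(term_val (mv_segment H P) d (Plus s t), term_val (mv_segment H Q) e (Plus s t))
        \<in> combs n (N1 + N2 + 1) d e"
      using combs_of_int[of 1 "N1 + N2 + 1" n d e] combs_mono[OF xy] by (simp add: mv_segment_def)
  qed simp
next
  case (Neg t)
  then obtain N where N: "N \<ge> 1" "\<And>M d e. back_forth H n N M P Q d e \<Longrightarrow>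
      (term_val (mv_segment H P) d t, term_val (mv_segment H Q) e t) \<in> combs n N d e"
    by auto
  show ?case
  proof (intro exI[of _ "1 + N"] conjI allI impI)
    fix M d e assume bf: "back_forth H n (1 + N) M P Q d e"
    have "back_forth H n N M P Q d e"
      by (rule P.back_forth_mono[OF bf]) auto
    then show "(term_val (mv_segment H P) d (Neg t), term_val (mv_segment H Q) e (Neg t)) \<in> combs n (1 + N) d e"
      using combs_diff[OF combs_of_int[of 1 1 n d e] N(2)] by (simp add: mv_segment_def)
  qed simp
qed

end

section \<open>Transfer of satisfaction between the two segments\<close>

primrec form_vars :: "mv_form \<Rightarrow> nat set"
  where
    "form_vars (Eq s t) = term_vars s \<union> term_vars t"
  | "form_vars Falsum = {}"
  | "form_vars (Imp p q) = form_vars p \<union> form_vars q"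
  | "form_vars (All i p) = insert i (form_vars p)"

lemma finite_term_vars: "finite (term_vars t)"
  by (induction t) auto

lemma finite_form_vars: "finite (form_vars p)"
  by (induction p) (auto simp: finite_term_vars)

lemma two_regular_cones_sym: "two_regular_cones H P Q \<Longrightarrow> two_regular_cones H Q P"
  by (simp add: two_regular_cones_def)

text \<open>\<open>N\<close> and \<open>M\<close> do not depend on the environments; a quantifier
  enlarges them as the extension step demands. Bound variables count in \<open>form_vars\<close>
  because their values are stored in the environment at indices that must be below
  \<open>n\<close>.\<close>

lemma (in two_regular_cones) back_forth_sat:
  assumes "form_vars p \<subseteq> {..<n}"
  shows "\<exists>N\<ge>1. \<exists>M\<ge>1. \<forall>d e. back_forth H n N M P Q d e \<longrightarrow>
    (sat (mv_segment H P) d p \<longleftrightarrow> sat (mv_segment H Q) e p)"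
  using assms
proof (induction p)
  case (Eq s t)
  then obtain N1 N2 where
    1: "N1 \<ge> 1" "\<And>M d e. back_forth H n N1 M P Q d e \<Longrightarrow>
      (term_val (mv_segment H P) d s, term_val (mv_segment H Q) e s) \<in> combs n N1 d e" and
    2: "N2 \<ge> 1" "\<And>M d e. back_forth H n N2 M P Q d e \<Longrightarrow>
      (term_val (mv_segment H P) d t, term_val (mv_segment H Q) e t) \<in> combs n N2 d e"
    using back_forth_term[of s n] back_forth_term[of t n] by auto
  show ?case
  proof (rule exI[of _ "N1 + N2"], rule conjI, use 1 in simp, rule exI[of _ 1], safe)
    fix d e assume bf: "back_forth H n (N1 + N2) 1 P Q d e"
    let ?x = "term_val (mv_segment H P) d s - term_val (mv_segment H P) d t"
    let ?y = "term_val (mv_segment H Q) e s - term_val (mv_segment H Q) e t"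
    have xy: "(?x, ?y) \<in> combs n (N1 + N2) d e"
      by (rule combs_diff[OF 1(2) 2(2)]; rule P.back_forth_mono[OF bf]) auto
    then have "?x \<in> P \<longleftrightarrow> ?y \<in> Q" "- ?x \<in> P \<longleftrightarrow> - ?y \<in> Q"
      using back_forthD(4)[OF bf] combs_uminus[OF xy] by blast+
    then have "?x = 0 \<longleftrightarrow> ?y = 0"
      using P.total_cone[of ?x] Q.total_cone[of ?y] P.back_forth_combs_mem[OF bf xy] P.zero_cone Q.zero_cone
      by (metis neg_equal_0_iff_equal)
    then show "sat (mv_segment H P) d (Eq s t) \<Longrightarrow> sat (mv_segment H Q) e (Eq s t)"
      "sat (mv_segment H Q) e (Eq s t) \<Longrightarrow> sat (mv_segment H P) d (Eq s t)"
      by simp_all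
  qed
next
  case Falsum
  then show ?case by auto
next
  case (Imp p q)
  then obtain N1 M1 N2 M2 where
    1: "N1 \<ge> 1" "M1 \<ge> 1" "\<And>d e. back_forth H n N1 M1 P Q d e \<Longrightarrow>
      sat (mv_segment H P) d p \<longleftrightarrow> sat (mv_segment H Q) e p" and
    2: "N2 \<ge> 1" "M2 \<ge> 1" "\<And>d e. back_forth H n N2 M2 P Q d e \<Longrightarrow>
      sat (mv_segment H P) d q \<longleftrightarrow> sat (mv_segment H Q) e q"
    by auto
  have "sat (mv_segment H P) d (Imp p q) \<longleftrightarrow> sat (mv_segment H Q) e (Imp p q)"
    if bf: "back_forth H n (N1 + N2) (M1 * M2) P Q d e" for d e
  proof -
    have "back_forth H n N1 M1 P Q d e" "back_forth H n N2 M2 P Q d e"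
      by (rule P.back_forth_mono[OF bf]; simp)+
    then show ?thesis
      using 1(3) 2(3) by simp
  qed
  moreover have "N1 + N2 \<ge> 1" "M1 * M2 \<ge> 1"
    using 1(1,2) 2(2) by auto
  ultimately show ?case by blast
next
  case (All i p)
  then obtain N M where
    NM: "N \<ge> 1" "M \<ge> 1" "\<And>d e. back_forth H n N M P Q d e \<Longrightarrow>
      sat (mv_segment H P) d p \<longleftrightarrow> sat (mv_segment H Q) e p"
    by auto
  have i: "i < n"
    using All.prems by simp
  \<comment> \<open>Exchanging the orders gives the other direction of the game.\<close>
  interpret sym: two_regular_cones H Q P
    by (rule two_regular_cones_sym) unfold_locales
  let ?N = "N * (fact N * N) + fact N * N" and ?M = "fact N * M"
  have "sat (mv_segment H P) d (All i p) \<longleftrightarrow> sat (mv_segment H Q) e (All i p)"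
    if bf: "back_forth H n ?N ?M P Q d e" for d e
  proof
    assume *: "sat (mv_segment H P) d (All i p)"
    show "sat (mv_segment H Q) e (All i p)"
      unfolding sat.simps
    proof
      fix b assume "b \<in> carrier (mv_segment H Q)"
      then obtain a where "a \<in> carrier (mv_segment H P)" "back_forth H n N M Q P (e(i := b)) (d(i := a))"
        using sym.back_forth_step[OF P.back_forth_sym[OF bf] NM(1,2) i] by blast
      then show "sat (mv_segment H Q) (e(i := b)) p"
        using * NM(3) P.back_forth_sym by fastforce
    qed
  next
    assume *: "sat (mv_segment H Q) e (All i p)"
    show "sat (mv_segment H P) d (All i p)"
      unfolding sat.simps
    proof
      fix a assume "a \<in> carrier (mv_segment H P)"
      then obtain b where "b \<in> carrier (mv_segment H Q)" "back_forth H n N M P Q (d(i := a)) (e(i := b))"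
        using back_forth_step[OF bf NM(1,2) i] by blast
      then show "sat (mv_segment H P) (d(i := a)) p"
        using * NM(3) by fastforce
    qed
  qed
  moreover have "?N \<ge> 1" "?M \<ge> 1"
    using NM(1,2) by (auto simp: Suc_le_eq)
  ultimately show ?case by blast
qed

text \<open>At the zero environments all combinations are integers, which every cone containing 1
  orders in the same way. So the game can start there with any bounds.\<close>

lemma (in two_regular_cones) sat_zero_env_iff:
  "sat (mv_segment H P) (\<lambda>_. 0) p \<longleftrightarrow> sat (mv_segment H Q) (\<lambda>_. 0) p"
proof -
  obtain n where n: "form_vars p \<subseteq> {..<n}"
    using finite_form_vars[of p] unfolding finite_nat_set_iff_bounded by blast
  obtain N M where NM: "\<And>d e. back_forth H n N M P Q d e \<Longrightarrow>
    sat (mv_segment H P) d p \<longleftrightarrow> sat (mv_segment H Q) e p"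
    using back_forth_sat[OF n] by blast
  have "back_forth H n N M P Q (\<lambda>_. 0) (\<lambda>_. 0)"
  proof (rule back_forthI)
    have "0 \<in> carrier (mv_segment H P)" "0 \<in> carrier (mv_segment H Q)"
      using P.zero_mem P.zero_cone Q.zero_cone P.uminus_cone[OF P.one_cone] Q.uminus_cone[OF Q.one_cone]
      by (auto simp: mv_segment_def)
    then show "0 \<in> carrier (mv_segment H P)" "0 \<in> carrier (mv_segment H Q)"
      by auto
    show "\<exists>h\<in>H. (0::real) - 0 = of_nat M * h"
      using P.zero_mem by (intro bexI[of _ 0]) auto
    fix x y assume "(x, y) \<in> combs n N (\<lambda>_. 0) (\<lambda>_. 0)"
    then obtain k :: int where "x = of_int k" "y = of_int k"
      by (auto elim!: combsE)
    then show "x \<in> P \<longleftrightarrow> y \<in> Q"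
      using P.of_int_mult_cone_iff[OF P.one_cone, of k] Q.of_int_mult_cone_iff[OF Q.one_cone, of k] by simp
  qed
  then show ?thesis by (rule NM)
qed

section \<open>Regular MV-chains as segments of subgroups of the reals\<close>

text \<open>Order-free properties of a map \<open>\<phi>\<close> that extends to an embedding of Chang's group
  into the reals.\<close>

locale chain_real_map = mv_chain +
  fixes \<phi> :: "'a \<Rightarrow> real"
  assumes nontrivial: "\<zero> \<noteq> mv_one A"
    and map_zero: "\<phi> \<zero> = 0" and map_one: "\<phi> (mv_one A) = 1"
    and map_plus: "\<lbrakk>x \<in> carrier A; y \<in> carrier A; x \<oplus> y \<noteq> mv_one A\<rbrakk> \<Longrightarrow> \<phi> (x \<oplus> y) = \<phi> x + \<phi> y"
    and map_carry: "\<lbrakk>x \<in> carrier A; y \<in> carrier A; x \<noteq> mv_one A; y \<noteq> mv_one A; x \<oplus> y = mv_one A\<rbrakk>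
      \<Longrightarrow> \<phi> x + \<phi> y = 1 + \<phi> (x \<ominus> \<sim> y)"
    and map_inject: "\<lbrakk>x \<in> carrier A; y \<in> carrier A; x \<noteq> mv_one A; y \<noteq> mv_one A;
      of_int m + \<phi> x = of_int n + \<phi> y\<rbrakk> \<Longrightarrow> m = n \<and> x = y"
begin

definition H :: "real set"
  where "H = {of_int m + \<phi> a |m a. a \<in> carrier A \<and> a \<noteq> \<one>}"

text \<open>Since \<open>a\<close> represents a fractional part in [0, 1), m + a is positive in
  Chang's group iff m \<ge> 0 and the pair is not (0, 0). The sign is read from the pair, which
  \<open>map_inject\<close> makes unique, and not from the real number.\<close>

definition P :: "real set"
  where "P = {of_int m + \<phi> a |m a. a \<in> carrier A \<and> a \<noteq> \<one> \<and> m \<ge> 0 \<and> (m = 0 \<longrightarrow> a \<noteq> \<zero>)}"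

lemma HI: "a \<in> carrier A \<Longrightarrow> a \<noteq> \<one> \<Longrightarrow> of_int m + \<phi> a \<in> H"
  unfolding H_def by blast

lemma HE:
  assumes "x \<in> H"
  obtains m a where "a \<in> carrier A" "a \<noteq> \<one>" "x = of_int m + \<phi> a"
  using assms unfolding H_def by blast

lemma mem_P_iff:
  assumes "a \<in> carrier A" "a \<noteq> \<one>"
  shows "of_int m + \<phi> a \<in> P \<longleftrightarrow> m \<ge> 0 \<and> (m = 0 \<longrightarrow> a \<noteq> \<zero>)"
proof
  assume "of_int m + \<phi> a \<in> P"
  then obtain n b where "b \<in> carrier A" "b \<noteq> \<one>" "n \<ge> 0" "n = 0 \<longrightarrow> b \<noteq> \<zero>"
    "of_int m + \<phi> a = of_int n + \<phi> b"
    unfolding P_def by blast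
  then show "m \<ge> 0 \<and> (m = 0 \<longrightarrow> a \<noteq> \<zero>)"
    using map_inject[of a b m n] assms by simp
qed (use assms in \<open>unfold P_def; blast\<close>)

lemma P_subset_H: "P \<subseteq> H"
  unfolding P_def H_def by blast

lemma map_neg: "x \<in> carrier A \<Longrightarrow> \<phi> (\<sim> x) = 1 - \<phi> x"
proof (cases "x = \<zero> \<or> x = \<one>")
  case False
  assume "x \<in> carrier A"
  then show ?thesis
    using False map_carry[of x "\<sim> x"] by (simp add: map_zero diff_self)
qed (auto simp: map_zero map_one)

lemma map_mem_P_iff: "a \<in> carrier A \<Longrightarrow> \<phi> a \<in> P \<longleftrightarrow> a \<noteq> \<zero>"
  using mem_P_iff[of a 0] mem_P_iff[of "\<zero>" 1] nontrivial
  by (cases "a = \<one>") (auto simp: map_one map_zero)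

lemma map_mem_H: "a \<in> carrier A \<Longrightarrow> \<phi> a \<in> H"
  using HI[of a 0] HI[of "\<zero>" 1] nontrivial by (cases "a = \<one>") (auto simp: map_one map_zero)

text \<open>\<open>m\<close> is the carry, 0 or 1. The last clause, that a sum vanishes only if both
  fractional parts do, keeps sums of positive elements positive.\<close>

lemma add_map_mem:
  assumes "a \<in> carrier A" "a \<noteq> \<one>" "b \<in> carrier A" "b \<noteq> \<one>"
  obtains m c where "c \<in> carrier A" "c \<noteq> \<one>" "m \<ge> 0" "\<phi> a + \<phi> b = of_int m + \<phi> c"
    "m = 0 \<Longrightarrow> c = \<zero> \<Longrightarrow> a = \<zero> \<and> b = \<zero>"
proof (cases "a \<oplus> b = \<one>")
  case True
  then show thesis
    using map_carry[of a b] diff_neg_neq_one[of a b] assms by (intro that[of "a \<ominus> \<sim> b" 1]) auto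
next
  case False
  then show thesis
    using map_plus[of a b] assms plus_eq_zero[of a b] plus_eq_zero[of b a]
    by (intro that[of "a \<oplus> b" 0]) (auto simp: plus_comm)
qed

lemma uminus_mem:
  assumes "x \<in> H"
  shows "- x \<in> H"
proof -
  obtain m a where x: "a \<in> carrier A" "a \<noteq> \<one>" "x = of_int m + \<phi> a"
    using assms by (rule HE)
  show ?thesis
  proof (cases "a = \<zero>")
    case True
    then show ?thesis
      using HI[of "\<zero>" "- m"] x nontrivial by (simp add: map_zero)
  next
    case False
    then show ?thesis
      using HI[of "\<sim> a" "- m - 1"] x by (simp add: map_neg)
  qed
qed

sublocale unit_subgroup H
proof
  show "1 \<in> H"
    using map_mem_H[of "\<one>"] by (simp add: map_one)
  fix x y assume xy: "x \<in> H" "y \<in> H"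
  obtain m a where a: "a \<in> carrier A" "a \<noteq> \<one>" "x = of_int m + \<phi> a"
    using xy(1) by (rule HE)
  obtain n b where b: "b \<in> carrier A" "b \<noteq> \<one>" "- y = of_int n + \<phi> b"
    using uminus_mem[OF xy(2)] by (rule HE)
  obtain k c where c: "c \<in> carrier A" "c \<noteq> \<one>" "\<phi> a + \<phi> b = of_int k + \<phi> c"
    using add_map_mem a b by metis
  then have "x - y = of_int (m + n + k) + \<phi> c"
    using a(3) b(3) by simp
  then show "x - y \<in> H"
    using HI[OF c(1,2)] by metis
qed

lemma add_cone:
  assumes "x \<in> P" "y \<in> P"
  shows "x + y \<in> P"
proof -
  obtain m a where a: "a \<in> carrier A" "a \<noteq> \<one>" "m \<ge> 0" "m = 0 \<longrightarrow> a \<noteq> \<zero>" "x = of_int m + \<phi> a"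
    using assms(1) unfolding P_def by blast
  obtain n b where b: "b \<in> carrier A" "b \<noteq> \<one>" "n \<ge> 0" "n = 0 \<longrightarrow> b \<noteq> \<zero>" "y = of_int n + \<phi> b"
    using assms(2) unfolding P_def by blast
  obtain k c where c: "c \<in> carrier A" "c \<noteq> \<one>" "k \<ge> 0" "\<phi> a + \<phi> b = of_int k + \<phi> c"
    "k = 0 \<Longrightarrow> c = \<zero> \<Longrightarrow> a = \<zero> \<and> b = \<zero>"
    using add_map_mem[OF a(1,2) b(1,2)] by metis
  then have "x + y = of_int (m + n + k) + \<phi> c"
    using a b by simp
  then show ?thesis
    using mem_P_iff[OF c(1,2), of "m + n + k"] a(3,4) b(3) c(3,5) by auto
qed

lemma add_cone_weak: "x \<in> P \<Longrightarrow> y = 0 \<or> y \<in> P \<Longrightarrow> x + y \<in> P"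
  using add_cone by auto

lemma total_cone:
  assumes "x \<in> H" "x \<noteq> 0"
  shows "x \<in> P \<or> - x \<in> P"
proof -
  obtain m a where x: "a \<in> carrier A" "a \<noteq> \<one>" "x = of_int m + \<phi> a"
    using assms(1) by (rule HE)
  show ?thesis
  proof (cases "m \<ge> 0")
    case True
    have "\<not> (m = 0 \<and> a = \<zero>)"
      using assms(2) x(3) map_zero by auto
    then have "of_int m + \<phi> a \<in> P"
      using True by (subst mem_P_iff[OF x(1,2)]) blast
    then show ?thesis
      using x(3) by simp
  next
    case False
    show ?thesis
    proof (cases "a = \<zero>")
      case True
      then have "of_int (- m) + \<phi> \<zero> \<in> P"
        using \<open>\<not> m \<ge> 0\<close> nontrivial by (subst mem_P_iff) auto
      then show ?thesis
        using x(3) True by (simp add: map_zero)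
    next
      case a0: False
      then have "of_int (- m - 1) + \<phi> (\<sim> a) \<in> P"
        using False x(1,2) by (subst mem_P_iff) auto
      then show ?thesis
        using x(1,3) by (simp add: map_neg)
    qed
  qed
qed

lemma zero_cone: "0 \<notin> P"
  using map_mem_P_iff[of "\<zero>"] by (simp add: map_zero)

lemma one_cone: "1 \<in> P"
  using map_mem_P_iff[of "\<one>"] nontrivial by (simp add: map_one)

lemma uminus_cone: "x \<in> P \<Longrightarrow> - x \<notin> P"
  using add_cone[of x "- x"] zero_cone by auto

lemma less_imp_diff_mem_P:
  assumes "mv_less A x y" and [simp]: "x \<in> carrier A" "y \<in> carrier A"
  shows "\<phi> y - \<phi> x \<in> P"
\<comment> \<open>\<open>map_plus\<close> does not apply to a sum equal to \<open>\<one>\<close>;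
  there the difference is the image of \<open>\<sim> x\<close>.\<close>
proof (cases "y = \<one>")
  case True
  then have "x \<noteq> \<one>"
    using assms(1) by (simp add: mv_less_def)
  then show ?thesis
    using map_mem_P_iff[of "\<sim> x"] True by (simp add: map_neg map_one)
next
  case False
  have y: "x \<oplus> (y \<ominus> x) = y"
    using assms by (intro plus_diff) (auto simp: mv_less_def)
  then have "y \<ominus> x \<noteq> \<zero>"
    using assms(1) by (auto simp: mv_less_def)
  then show ?thesis
    using map_plus[of x "y \<ominus> x"] map_mem_P_iff[of "y \<ominus> x"] y False by simp
qed

lemma diff_mem_P_iff:
  assumes "x \<in> carrier A" "y \<in> carrier A"
  shows "\<phi> y - \<phi> x \<in> P \<longleftrightarrow> mv_less A x y"
proof
  assume *: "\<phi> y - \<phi> x \<in> P"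
  show "mv_less A x y"
  proof (rule ccontr)
    assume "\<not> mv_less A x y"
    then have "mv_le A y x"
      using not_le assms by blast
    then have "y = x \<or> \<phi> x - \<phi> y \<in> P"
      using less_imp_diff_mem_P assms by (auto simp: mv_less_def)
    then show False
      using * zero_cone uminus_cone by fastforce
  qed
qed (use less_imp_diff_mem_P assms in blast)

lemma image_carrier: "\<phi> ` carrier A = carrier (mv_segment H P)"
proof
  show "\<phi> ` carrier A \<subseteq> carrier (mv_segment H P)"
  proof clarify
    fix a assume [simp]: "a \<in> carrier A"
    have "- \<phi> a \<notin> P" "\<phi> a - 1 \<notin> P"
      using diff_mem_P_iff[of a "\<zero>"] diff_mem_P_iff[of "\<one>" a] zero_le le_one le_antisym
      by (auto simp: map_zero map_one mv_less_def)
    then show "\<phi> a \<in> carrier (mv_segment H P)"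
      by (simp add: mv_segment_def map_mem_H)
  qed
  show "carrier (mv_segment H P) \<subseteq> \<phi> ` carrier A"
  proof
    fix x assume "x \<in> carrier (mv_segment H P)"
    then have x: "x \<in> H" "- x \<notin> P" "x - 1 \<notin> P"
      by (simp_all add: mv_segment_def)
    obtain m a where a: "a \<in> carrier A" "a \<noteq> \<one>" "x = of_int m + \<phi> a"
      using x(1) by (rule HE)
    have "m \<ge> 0"
    proof (cases "a = \<zero>")
      case True
      then show ?thesis
        using x(2) a mem_P_iff[of "\<zero>" "- m"] nontrivial by (auto simp: map_zero)
    next
      case False
      then show ?thesis
        using x(2) a mem_P_iff[of "\<sim> a" "- m - 1"] by (auto simp: map_neg)
    qed
    moreover have "m \<le> 1" "m = 1 \<Longrightarrow> a = \<zero>"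
      using x(3) a mem_P_iff[of a "m - 1"] by (auto simp: algebra_simps)
    \<comment> \<open>Between 0 and 1 only the pairs \<open>(0, a)\<close> and
      \<open>(1, \<zero>)\<close> remain; the latter represents the image of \<open>\<one>\<close>,
      which is not itself a fractional part.\<close>
    ultimately consider "m = 0" | "m = 1" "a = \<zero>"
      by linarith
    then show "x \<in> \<phi> ` carrier A"
    proof cases
      case 2
      then have "x = \<phi> \<one>"
        using a by (simp add: map_zero map_one)
      then show ?thesis by simp
    qed (use a in auto)
  qed
qed

lemma embedding: "mv_embedding A (mv_segment H P) \<phi>"
  unfolding mv_embedding_def
proof (intro conjI ballI)
  show "\<phi> ` carrier A \<subseteq> carrier (mv_segment H P)"
    by (simp add: image_carrier)
  show "inj_on \<phi> (carrier A)"
  proof (rule inj_onI)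
    fix x y assume "x \<in> carrier A" "y \<in> carrier A" "\<phi> x = \<phi> y"
    then show "x = y"
      using diff_mem_P_iff[of x y] diff_mem_P_iff[of y x] zero_cone linear[of x y]
      by (auto simp: mv_less_def)
  qed
  show "\<phi> \<zero> = \<zero>\<^bsub>mv_segment H P\<^esub>"
    by (simp add: mv_segment_def map_zero)
  fix x assume [simp]: "x \<in> carrier A"
  show "\<phi> (\<sim> x) = \<sim>\<^bsub>mv_segment H P\<^esub> (\<phi> x)"
    by (simp add: mv_segment_def map_neg)
  fix y assume [simp]: "y \<in> carrier A"
  have *: "\<phi> x + \<phi> y - 1 \<in> P \<longleftrightarrow> mv_less A (\<sim> y) x"
    using diff_mem_P_iff[of "\<sim> y" x] by (simp add: map_neg algebra_simps)
  show "\<phi> (x \<oplus> y) = \<phi> x \<oplus>\<^bsub>mv_segment H P\<^esub> \<phi> y"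
  proof (cases "mv_less A (\<sim> y) x")
    case True
    then have "x \<oplus> y = \<one>"
      by (simp add: mv_less_def neg_le_iff plus_comm)
    then show ?thesis
      using * True by (simp add: mv_segment_def map_one)
  next
    case False
    have "\<phi> (x \<oplus> y) = \<phi> x + \<phi> y"
    \<comment> \<open>The segment truncates only sums strictly beyond 1. In the borderline case
      \<open>x\<close> is \<open>\<sim> y\<close> and the real sum is exactly 1.\<close>
    proof (cases "x \<oplus> y = \<one>")
      case True
      then have "x = \<sim> y"
        using False by (simp add: mv_less_def neg_le_iff plus_comm)
      then show ?thesis
        using True by (simp add: map_neg map_one)
    qed (simp add: map_plus)
    then show ?thesis
      using * False by (simp add: mv_segment_def)
  qed
qed

lemma map_nmult: "x \<in> carrier A \<Longrightarrow> mv_nmult A n x \<noteq> \<one> \<Longrightarrow> \<phi> (mv_nmult A n x) = of_nat n * \<phi> x"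
proof (induction n)
  case (Suc n)
  then have "mv_nmult A n x \<noteq> \<one>"
    by auto
  then show ?case
    using Suc map_plus[of "mv_nmult A n x" x] by (simp add: distrib_right)
qed (simp add: map_zero)

text \<open>Multiples of \<open>n\<close> occur arbitrarily closely above \<open>x\<close>. In this
  form the property is additive in \<open>x\<close>, so it can be checked on the elements of the
  segment below the unit and on 1 and -1.\<close>

definition approximable :: "nat \<Rightarrow> real \<Rightarrow> bool"
  where "approximable n x \<longleftrightarrow>
    (\<forall>\<epsilon>\<in>P. \<exists>g\<in>H. of_nat n * g - x \<in> P \<and> x + \<epsilon> - of_nat n * g \<in> P)"

lemma cone_min:
  assumes "x \<in> P" "y \<in> P"
  obtains z where "z \<in> P" "z = x \<or> x - z \<in> P" "z = y \<or> y - z \<in> P"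
  using assms total_cone[of "x - y"] diff_mem P_subset_H that[of x] that[of y]
  by (cases "x = y") auto

end

section \<open>Regularity of the cone\<close>

locale regular_chain_real_map = chain_real_map +
  assumes dense: "mv_dense A"
    and regular_between: "n \<ge> 2 \<Longrightarrow> mv_regular_between A n"
begin

lemma obtain_proper:
  obtains y where "y \<in> carrier A" "y \<noteq> \<zero>" "y \<noteq> \<one>"
  using dense nontrivial unfolding mv_dense_def mv_less_def by (metis one_closed)

lemma cone_dense:
  assumes "\<epsilon> \<in> P"
  obtains \<delta> where "\<delta> \<in> P" "\<epsilon> - \<delta> \<in> P"
proof -
  obtain m a where a: "a \<in> carrier A" "a \<noteq> \<one>" "m \<ge> 0" "m = 0 \<longrightarrow> a \<noteq> \<zero>" "\<epsilon> = of_int m + \<phi> a"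
    using assms unfolding P_def by blast
  show thesis
  proof (cases "m = 0")
    case True
    then obtain y where y: "y \<in> carrier A" "y \<noteq> \<zero>" "mv_less A y a"
      using dense a unfolding mv_dense_def by blast
    then show thesis
      using that[of "\<phi> y"] True a diff_mem_P_iff[of y a] by (simp add: map_mem_P_iff)
  next
    case False
    \<comment> \<open>For m \<ge> 1 any \<open>y\<close> strictly between 0 and 1 works, as m + a -
      y = (m - 1 + a) + (1 - y).\<close>
    obtain y where y: "y \<in> carrier A" "y \<noteq> \<zero>" "y \<noteq> \<one>"
      by (rule obtain_proper)
    have "of_int (m - 1) + \<phi> a = 0 \<or> of_int (m - 1) + \<phi> a \<in> P"
      using mem_P_iff[OF a(1,2), of "m - 1"] False a(3) by (auto simp: map_zero)
    moreover have "\<phi> (\<sim> y) \<in> P"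
      using y by (simp add: map_mem_P_iff)
    moreover have "\<epsilon> - \<phi> y = (of_int (m - 1) + \<phi> a) + \<phi> (\<sim> y)"
      using a y by (simp add: map_neg)
    ultimately have "\<epsilon> - \<phi> y \<in> P"
      using add_cone by fastforce
    then show thesis
      using that[of "\<phi> y"] y by (simp add: map_mem_P_iff)
  qed
qed

text \<open>\<open>\<epsilon>\<close> need not be divisible by 2; the smaller part of a splitting of
  \<open>\<epsilon>\<close> into two positive parts replaces the half.\<close>

lemma cone_halve:
  assumes "\<epsilon> \<in> P"
  obtains \<delta> where "\<delta> \<in> P" "\<epsilon> = \<delta> + \<delta> \<or> \<epsilon> - (\<delta> + \<delta>) \<in> P"
proof -
  obtain z where z: "z \<in> P" "\<epsilon> - z \<in> P"
    using cone_dense assms by blast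
  obtain w where w: "w \<in> P" "w = z \<or> z - w \<in> P" "w = \<epsilon> - z \<or> \<epsilon> - z - w \<in> P"
    using cone_min[OF z] by blast
  have "\<epsilon> - (w + w) = (z - w) + (\<epsilon> - z - w)"
    by simp
  then have "\<epsilon> = w + w \<or> \<epsilon> - (w + w) \<in> P"
    using w(2,3) add_cone[of "z - w" "\<epsilon> - z - w"] by auto
  then show thesis
    using that w(1) by blast
qed

lemma approximable_add:
  assumes "approximable n x" "approximable n y"
  shows "approximable n (x + y)"
  unfolding approximable_def
proof
  fix \<epsilon> assume "\<epsilon> \<in> P"
  then obtain \<delta> where d: "\<delta> \<in> P" "\<epsilon> = \<delta> + \<delta> \<or> \<epsilon> - (\<delta> + \<delta>) \<in> P"
    by (rule cone_halve)
  obtain g where g: "g \<in> H" "of_nat n * g - x \<in> P" "x + \<delta> - of_nat n * g \<in> P"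
    using assms(1) d(1) unfolding approximable_def by blast
  obtain h where h: "h \<in> H" "of_nat n * h - y \<in> P" "y + \<delta> - of_nat n * h \<in> P"
    using assms(2) d(1) unfolding approximable_def by blast
  have "of_nat n * (g + h) - (x + y) \<in> P"
    using add_cone[OF g(2) h(2)] by (simp add: algebra_simps)
  moreover have "x + y + \<epsilon> - of_nat n * (g + h) \<in> P"
  proof -
    define S where "S = (x + \<delta> - of_nat n * g) + (y + \<delta> - of_nat n * h)"
    have S: "S \<in> P"
      unfolding S_def by (rule add_cone[OF g(3) h(3)])
    have eq: "x + y + \<epsilon> - of_nat n * (g + h) = S + (\<epsilon> - (\<delta> + \<delta>))"
      by (simp add: S_def algebra_simps)
    show ?thesis
      unfolding eq by (rule add_cone_weak[OF S]) (use d(2) in auto)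
  qed
  ultimately show "\<exists>g\<in>H. of_nat n * g - (x + y) \<in> P \<and> x + y + \<epsilon> - of_nat n * g \<in> P"
    using add_mem[OF g(1) h(1)] by blast
qed

lemma approximable_map:
  assumes [simp]: "a \<in> carrier A" and a1: "a \<noteq> \<one>" and n: "n \<ge> 2"
  shows "approximable n (\<phi> a)"
  unfolding approximable_def
proof
  fix \<epsilon> assume "\<epsilon> \<in> P"
  moreover have "\<phi> (\<sim> a) \<in> P"
    using a1 by (simp add: map_mem_P_iff)
  \<comment> \<open>\<open>e\<close> is the minimum of \<open>\<epsilon>\<close> and 1 - a, which
    keeps a + e inside the segment.\<close>
  ultimately obtain e where e: "e \<in> P" "e = \<epsilon> \<or> \<epsilon> - e \<in> P" "e = \<phi> (\<sim> a) \<or> \<phi> (\<sim> a) - e \<in> P"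
    by (rule cone_min)
  have "\<phi> a + e \<in> carrier (mv_segment H P)"
  proof -
    have "\<phi> a + e \<in> H"
      using add_mem map_mem_H e(1) P_subset_H by auto
    moreover have "\<phi> a + e \<in> P"
      using add_cone[of "\<phi> a" e] e(1) by (cases "a = \<zero>") (auto simp: map_mem_P_iff map_zero)
    then have "- (\<phi> a + e) \<notin> P"
      by (rule uminus_cone)
    moreover have "\<phi> a + e - 1 \<notin> P"
    proof -
      have "1 - (\<phi> a + e) = 0 \<or> 1 - (\<phi> a + e) \<in> P"
        using e(3) by (auto simp: map_neg algebra_simps)
      then show ?thesis
        using uminus_cone[of "1 - (\<phi> a + e)"] zero_cone by auto
    qed
    ultimately show ?thesis
      by (simp add: mv_segment_def)
  qed
  then obtain c where c [simp]: "c \<in> carrier A" and ce: "\<phi> c = \<phi> a + e"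
    using image_carrier by (metis imageE)
  have "mv_less A a c"
    using diff_mem_P_iff[of a c] e(1) ce by simp
  \<comment> \<open>Regularity yields only weak inequalities and asks for a nonzero left end;
    endpoints strictly between \<open>a\<close> and \<open>c\<close> take care of both.\<close>
  then obtain z where z [simp]: "z \<in> carrier A" and az: "mv_less A a z" and zc: "mv_less A z c"
    using dense_between[OF dense, of a c] by auto
  obtain x where x [simp]: "x \<in> carrier A" and ax: "mv_less A a x" and xz: "mv_less A x z"
    using dense_between[OF dense az] by auto
  have "x \<noteq> \<zero>"
    using ax le_antisym[OF _ zero_le, of a] unfolding mv_less_def by auto
  then obtain y where y [simp]: "y \<in> carrier A" and xy: "mv_le A x (mv_nmult A n y)"
    and yz: "mv_le A (mv_nmult A n y) z"
    using regular_between[OF n] xz unfolding mv_regular_between_def by fastforce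
  have less: "mv_less A a (mv_nmult A n y)" "mv_less A (mv_nmult A n y) c"
    using less_le_trans[OF ax xy] le_less_trans[OF yz zc] by simp_all
  then have "mv_nmult A n y \<noteq> \<one>"
    using le_antisym[of "\<one>" c] le_one[of c] unfolding mv_less_def by auto
  then have *: "\<phi> (mv_nmult A n y) = of_nat n * \<phi> y"
    by (simp add: map_nmult)
  have "of_nat n * \<phi> y - \<phi> a \<in> P" "\<phi> a + e - of_nat n * \<phi> y \<in> P"
    using less diff_mem_P_iff[of a "mv_nmult A n y"] diff_mem_P_iff[of "mv_nmult A n y" c] * ce by simp_all
  moreover have eq: "\<phi> a + \<epsilon> - of_nat n * \<phi> y = (\<phi> a + e - of_nat n * \<phi> y) + (\<epsilon> - e)"
    by simp
  have "\<phi> a + \<epsilon> - of_nat n * \<phi> y \<in> P"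
    unfolding eq by (rule add_cone_weak[OF calculation(2)]) (use e(2) in auto)
  ultimately show "\<exists>g\<in>H. of_nat n * g - \<phi> a \<in> P \<and> \<phi> a + \<epsilon> - of_nat n * g \<in> P"
    using map_mem_H[of y] by auto
qed

text \<open>The unit is the sum of two elements strictly below it, \<open>y\<close> and
  \<open>\<sim> y\<close>.\<close>

lemma approximable_one:
  assumes "n \<ge> 2"
  shows "approximable n 1"
proof -
  obtain y where y: "y \<in> carrier A" "y \<noteq> \<zero>" "y \<noteq> \<one>"
    by (rule obtain_proper)
  then show ?thesis
    using approximable_add[OF approximable_map[of y] approximable_map[of "\<sim> y"]] assms
    by (simp add: map_neg)
qed

text \<open>Negation reverses the side of the approximation: 1 - e < n g < 1 gives -1 < -n g < -1 +
  e.\<close>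

lemma approximable_minus_one:
  assumes "n \<ge> 2"
  shows "approximable n (- 1)"
  unfolding approximable_def
proof
  fix \<epsilon> assume "\<epsilon> \<in> P"
  then obtain e where e: "e \<in> P" "e = \<epsilon> \<or> \<epsilon> - e \<in> P" "e = 1 \<or> 1 - e \<in> P"
    using cone_min[OF _ one_cone] by blast
  have "1 - e \<in> carrier (mv_segment H P)"
    using e P_subset_H one_mem diff_mem uminus_cone[of "1 - e"] uminus_cone[of e] zero_cone
    by (auto simp: mv_segment_def)
  then obtain c where c: "c \<in> carrier A" "\<phi> c = 1 - e"
    using image_carrier by (metis imageE)
  have "c \<noteq> \<one>"
    using c e(1) zero_cone map_one by auto
  then obtain g where g: "g \<in> H" "of_nat n * g - (1 - e) \<in> P" "(1 - e) + e - of_nat n * g \<in> P"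
    using approximable_map[OF c(1) _ assms] e(1) c(2) unfolding approximable_def by metis
  have eq: "- 1 + \<epsilon> - of_nat n * (- g) = (of_nat n * g - (1 - e)) + (\<epsilon> - e)"
    by simp
  have "- 1 + \<epsilon> - of_nat n * (- g) \<in> P"
    unfolding eq by (rule add_cone_weak[OF g(2)]) (use e(2) in auto)
  moreover have "of_nat n * (- g) - (- 1) \<in> P"
    using g(3) by simp
  ultimately show "\<exists>g\<in>H. of_nat n * g - - 1 \<in> P \<and> - 1 + \<epsilon> - of_nat n * g \<in> P"
    using uminus_mem[OF g(1)] by blast
qed

lemma approximable_mem:
  assumes "x \<in> H" "n \<ge> 2"
  shows "approximable n x"
proof -
  have int: "approximable n (of_int m)" for m
  proof (induction m rule: int_induct[where k = 0])
    case base
    then show ?case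
      using approximable_add[OF approximable_one approximable_minus_one] assms(2) by simp
  next
    case (step1 i)
    then show ?case
      using approximable_add[OF step1(2) approximable_one] assms(2) by simp
  next
    case (step2 i)
    then show ?case
      using approximable_add[OF step2(2) approximable_minus_one] assms(2) by simp
  qed
  obtain m a where "a \<in> carrier A" "a \<noteq> \<one>" "x = of_int m + \<phi> a"
    using assms(1) by (rule HE)
  then show ?thesis
    using approximable_add[OF int approximable_map] assms(2) by simp
qed

lemma regular_cone: "regular_cone H P"
proof (unfold_locales)
  fix x y :: real and n :: nat
  assume *: "x \<in> H" "y - x \<in> P" "n > 0"
  \<comment> \<open>Approximability is available from 2 on; passing to \<open>2 * n\<close> covers
    \<open>n = 1\<close>, with \<open>2 * g\<close> as the witness.\<close>
  obtain g where "g \<in> H" "of_nat (2 * n) * g - x \<in> P" "x + (y - x) - of_nat (2 * n) * g \<in> P"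
    using approximable_mem[OF *(1), of "2 * n"] * unfolding approximable_def by fastforce
  moreover from this have "2 * g \<in> H"
    using add_mem[of g g] by simp
  ultimately show "\<exists>g\<in>H. of_nat n * g - x \<in> P \<and> y - of_nat n * g \<in> P"
    by (intro bexI[of _ "2 * g"]) (auto simp: mult_ac)
qed (use P_subset_H zero_cone one_cone add_cone total_cone in blast)+

end

section \<open>From Chang's group to a real map on the chain\<close>

lemma (in mv_chain) obtain_chain_real_map:
  assumes nontrivial: "\<zero> \<noteq> mv_one A" and "countable (carrier A)"
  obtains \<phi> where "chain_real_map A \<phi>"
proof -
  interpret G: comm_group "chang_group A"
    by (rule comm_group_chang_group[OF nontrivial])
  note G_defs = chang_group_def chang_add_def
  have mem: "(m, a) \<in> carrier (chang_group A) \<longleftrightarrow> a \<in> carrier A \<and> a \<noteq> mv_one A" for m a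
    by (simp add: chang_group_def)
  \<comment> \<open>Powers of a non-identity element with nonnegative integer part stay of this
    kind. Every non-identity element or its inverse is such, whence torsion-freeness.\<close>
  have pow_pos: "fst (p [^]\<^bsub>chang_group A\<^esub> Suc n) \<ge> 0 \<and> p [^]\<^bsub>chang_group A\<^esub> Suc n \<noteq> (0, \<zero>)"
    if p: "p \<in> carrier (chang_group A)" "fst p \<ge> 0" "p \<noteq> (0, \<zero>)" for p and n :: nat
  proof (induction n)
    case (Suc n)
    have "p [^]\<^bsub>chang_group A\<^esub> Suc n \<in> carrier (chang_group A)"
      using p(1) by (rule G.nat_pow_closed)
    then show ?case
      using Suc p plus_eq_zero[of "snd (p [^]\<^bsub>chang_group A\<^esub> Suc n)" "snd p"]
        G.nat_pow_Suc[of p "Suc n"]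
      by (cases p; cases "p [^]\<^bsub>chang_group A\<^esub> Suc n") (auto simp: G_defs)
  qed (use p in simp)
  have torsion_free: "x = one (chang_group A)"
    if x: "x \<in> carrier (chang_group A)" "k \<noteq> 0" "x [^]\<^bsub>chang_group A\<^esub> (k::int) = one (chang_group A)" for x k
  proof (rule ccontr)
    assume "x \<noteq> one (chang_group A)"
    define n where "n = nat \<bar>k\<bar> - 1"
    have n: "nat \<bar>k\<bar> = Suc n"
      using x(2) by (simp add: n_def)
    have pow: "x [^]\<^bsub>chang_group A\<^esub> Suc n = one (chang_group A)"
      using x n G.inv_eq_1_iff[of "x [^]\<^bsub>chang_group A\<^esub> Suc n"]
      by (auto simp: int_pow_def2 simp del: nat_pow_Suc split: if_splits)
    obtain m a where ma: "x = (m, a)" "a \<in> carrier A" "a \<noteq> mv_one A"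
      using x(1) by (cases x) (simp add: mem)
    define y where "y = (if m \<ge> 0 then x else inv\<^bsub>chang_group A\<^esub> x)"
    have y: "y \<in> carrier (chang_group A)" "y [^]\<^bsub>chang_group A\<^esub> Suc n = one (chang_group A)"
      using x(1) pow by (auto simp: y_def G.nat_pow_inv simp del: nat_pow_Suc G.nat_pow_Suc)
    have "y \<noteq> one (chang_group A)"
      using \<open>x \<noteq> _\<close> x(1) by (auto simp: y_def)
    then have "y \<noteq> (0, \<zero>)"
      by (simp add: chang_group_def)
    moreover have "fst y \<ge> 0"
    proof (cases "m \<ge> 0")
      case False
      define z where "z = (if a = \<zero> then (- m, \<zero>) else (- m - 1, \<sim> a))"
      have "z \<otimes>\<^bsub>chang_group A\<^esub> x = one (chang_group A)" "z \<in> carrier (chang_group A)"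
        using ma nontrivial by (auto simp: z_def G_defs diff_self)
      then have "y = z"
        using False G.inv_equality x(1) by (simp add: y_def)
      then show ?thesis
        using False by (simp add: z_def)
    qed (simp add: y_def ma)
    ultimately show False
      using pow_pos[OF y(1), of n] y(2) by (simp add: chang_group_def)
  qed
  have "countable (carrier (chang_group A))"
    using assms(2) by (simp add: chang_group_def)
  moreover have "(1, \<zero>) \<in> carrier (chang_group A)" "(1, \<zero>) \<noteq> one (chang_group A)"
    using nontrivial by (auto simp: chang_group_def)
  ultimately obtain f :: "int \<times> 'a \<Rightarrow> real" where
    f: "\<And>x y. x \<in> carrier (chang_group A) \<Longrightarrow> y \<in> carrier (chang_group A) \<Longrightarrow>
      f (x \<otimes>\<^bsub>chang_group A\<^esub> y) = f x + f y"
    and inj: "inj_on f (carrier (chang_group A))" and f1: "f (1, \<zero>) = 1"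
    using G.countable_torsion_free_embeds_real[of "(1, \<zero>)"] torsion_free by blast
  have f_add: "f (chang_add A (m, a) (n, b)) = f (m, a) + f (n, b)"
    if "a \<in> carrier A" "a \<noteq> mv_one A" "b \<in> carrier A" "b \<noteq> mv_one A" for m n a b
    using f[of "(m, a)" "(n, b)"] that by (simp add: chang_group_def)
  have f_int: "f (m, \<zero>) = of_int m" for m
  proof (induction m rule: int_induct[where k = 0])
    case base
    then show ?case
      using f_add[of "\<zero>" "\<zero>" 0 0] nontrivial by (simp add: chang_add_def)
  next
    case (step1 i)
    then show ?case
      using f_add[of "\<zero>" "\<zero>" i 1] nontrivial f1 by (simp add: chang_add_def)
  next
    case (step2 i)
    then show ?case
      using f_add[of "\<zero>" "\<zero>" "i - 1" 1] nontrivial f1 by (simp add: chang_add_def)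
  qed
  \<comment> \<open>The unit of Chang's group is \<open>(1, \<zero>)\<close>, not
    \<open>(0, \<one>)\<close>, hence the separate value at \<open>\<one>\<close>.\<close>
  define \<phi> where "\<phi> a = (if a = mv_one A then 1 else f (0, a))" for a
  have f_eq: "f (m, a) = of_int m + \<phi> a" if "a \<in> carrier A" "a \<noteq> mv_one A" for m a
    using f_add[of "\<zero>" a m 0] f_int[of m] that nontrivial by (simp add: chang_add_def \<phi>_def)
  have "chain_real_map A \<phi>"
  proof (unfold_locales)
    show "\<zero> \<noteq> mv_one A"
      by (rule nontrivial)
    show "\<phi> \<zero> = 0" "\<phi> (mv_one A) = 1"
      using f_int[of 0] nontrivial by (simp_all add: \<phi>_def)
    fix x y assume xy: "x \<in> carrier A" "y \<in> carrier A"
    show "\<phi> (x \<oplus> y) = \<phi> x + \<phi> y" if *: "x \<oplus> y \<noteq> mv_one A"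
    proof -
      have "x \<noteq> mv_one A" "y \<noteq> mv_one A"
        using * xy by auto
      then show ?thesis
        using f_add[of x y 0 0] * xy by (simp add: chang_add_def \<phi>_def)
    qed
    assume ne: "x \<noteq> mv_one A" "y \<noteq> mv_one A"
    show "\<phi> x + \<phi> y = 1 + \<phi> (x \<ominus> \<sim> y)" if *: "x \<oplus> y = mv_one A"
      using f_add[of x y 0 0] f_eq[of "x \<ominus> \<sim> y" 1] f_eq[of x 0] f_eq[of y 0] * xy ne diff_neg_neq_one[of x y]
      by (simp add: chang_add_def)
    show "m = n \<and> x = y" if "of_int m + \<phi> x = of_int n + \<phi> y" for m n
      using inj_onD[OF inj, of "(m, x)" "(n, y)"] f_eq that xy ne by (simp add: mem)
  qed
  then show thesis by (rule that)
qed

section \<open>The usual order\<close>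

text \<open>If the infimum of the positive elements were positive, some x would lie below twice the
  infimum; for a smaller positive y both y and x - y are at least the infimum, a contradiction.
  Closure under positive differences is also available for the image of a simple chain, which is not
  a group.\<close>

lemma small_positive_element:
  fixes S :: "real set"
  assumes diff: "\<And>x y. x \<in> S \<Longrightarrow> y \<in> S \<Longrightarrow> x < y \<Longrightarrow> y - x \<in> S"
    and no_least: "\<And>x. x \<in> S \<Longrightarrow> 0 < x \<Longrightarrow> \<exists>y\<in>S. 0 < y \<and> y < x"
    and "z \<in> S" "0 < z" and "0 < \<epsilon>"
  obtains x where "x \<in> S" "0 < x" "x < \<epsilon>"
proof -
  define T where "T = {x \<in> S. 0 < x}"
  have ne: "T \<noteq> {}" and bdd: "bdd_below T"
    using assms(3,4) by (auto simp: T_def intro: bdd_belowI[of _ 0])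
  have "Inf T < \<epsilon>"
  proof (rule ccontr)
    assume "\<not> Inf T < \<epsilon>"
    then have "Inf T < 2 * Inf T"
      using assms(5) by simp
    then obtain x where x: "x \<in> S" "0 < x" "x < 2 * Inf T"
      using cInf_lessD[OF ne] unfolding T_def by blast
    obtain y where y: "y \<in> S" "0 < y" "y < x"
      using no_least x by blast
    then have "y \<in> T" "x - y \<in> T"
      using x diff by (auto simp: T_def)
    then have "Inf T \<le> y" "Inf T \<le> x - y"
      using bdd by (auto intro: cInf_lower)
    then show False
      using x(3) by linarith
  qed
  then show thesis
    using cInf_lessD[OF ne] that unfolding T_def by blast
qed

text \<open>The cone \<open>P\<close> serves to exclude that \<open>H\<close> is cyclic. Then
  \<open>H\<close> has arbitrarily small positive reals \<open>h\<close>, and the multiples of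
  \<open>n * h\<close> meet every interval longer than \<open>n * h\<close>.\<close>

lemma (in regular_cone) regular_cone_usual: "regular_cone H (H \<inter> {0<..})"
proof unfold_locales
  have no_least: "\<exists>y\<in>H. 0 < y \<and> y < x" if x: "x \<in> H" "0 < x" for x
  proof (rule ccontr)
    assume no: "\<not> (\<exists>y\<in>H. 0 < y \<and> y < x)"
    have multiple: "\<exists>k. g = of_int k * x" if g: "g \<in> H" for g
    proof -
      have "g - of_int \<lfloor>g / x\<rfloor> * x \<in> H"
        using g x(1) by (intro mem_intros)
      moreover have "0 \<le> g - of_int \<lfloor>g / x\<rfloor> * x" "g - of_int \<lfloor>g / x\<rfloor> * x < x"
        using x(2) floor_divide_lower[OF x(2), of g] floor_divide_upper[OF x(2), of g]
        by (auto simp: algebra_simps)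
      ultimately have "g - of_int \<lfloor>g / x\<rfloor> * x = 0"
        using no by force
      then show ?thesis by (intro exI[of _ "\<lfloor>g / x\<rfloor>"]) simp
    qed
    obtain w where w: "w \<in> P" "w = x \<or> w = - x"
      using total_cone[OF x(1)] x(2) by auto
    \<comment> \<open>\<open>w\<close> is the generator that is positive for \<open>P\<close>.
      Regularity with \<open>n = 1\<close> puts an element strictly between 0 and \<open>w\<close>,
      which no integer multiple of \<open>w\<close> can be.\<close>
    obtain g where g: "g \<in> H" "g \<in> P" "w - g \<in> P"
      using regular_cone[OF zero_mem, of w 1] w(1) cone_sub by auto
    obtain k where "g = of_int k * x"
      using multiple g(1) by blast
    then obtain l :: int where l: "g = of_int l * w"
      using w(2) by (metis minus_mult_minus of_int_minus)
    then have "w - g = of_int (1 - l) * w"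
      by (simp add: algebra_simps)
    then have "l > 0" "1 - l > 0"
      using of_int_mult_cone_iff[OF w(1)] g l by metis+
    then show False by simp
  qed
  fix x y :: real and n :: nat
  assume xy: "x \<in> H" "y \<in> H" "y - x \<in> H \<inter> {0<..}" "n > 0"
  obtain h where h: "h \<in> H" "0 < h" "h < (y - x) / of_nat n"
    by (rule small_positive_element[of H 1 "(y - x) / of_nat n"])
      (use no_least xy diff_mem one_mem in auto)
  \<comment> \<open>\<open>k\<close> is the first integer for which \<open>k * (n * h)\<close>
    exceeds \<open>x\<close>; one step \<open>n * h\<close> cannot jump over the interval.\<close>
  define k where "k = \<lfloor>x / (of_nat n * h)\<rfloor> + 1"
  have pos: "0 < of_nat n * h"
    using h(2) xy(4) by simp
  have "x < of_int k * (of_nat n * h)" "of_int k * (of_nat n * h) \<le> x + of_nat n * h"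
    using floor_divide_lower[OF pos, of x] floor_divide_upper[OF pos, of x]
    by (auto simp: k_def algebra_simps)
  moreover have "of_nat n * h < y - x"
    using h(3) xy(4) by (simp add: field_simps)
  ultimately have "x < of_nat n * (of_int k * h)" "of_nat n * (of_int k * h) < y"
    by (auto simp: mult_ac)
  then show "\<exists>g\<in>H. of_nat n * g - x \<in> H \<inter> {0<..} \<and> y - of_nat n * g \<in> H \<inter> {0<..}"
    using h(1) xy(1,2) by (intro bexI[of _ "of_int k * h"]) (auto intro!: mem_intros)
qed (auto intro: mem_intros)

lemma (in unit_subgroup) simple_segment_usual: "mv_simple (mv_segment H (H \<inter> {0<..}))"
proof -
  let ?B = "mv_segment H (H \<inter> {0<..})"
  have carrier: "carrier ?B = H \<inter> {0..1}"
    by (auto simp: mv_segment_def mem_intros not_less)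
  have plus: "x \<oplus>\<^bsub>?B\<^esub> y = min (x + y) 1" if "x \<in> H" "y \<in> H" for x y
    using that by (auto simp: mv_segment_def mem_intros)
  have ops: "\<sim>\<^bsub>?B\<^esub> x = 1 - x" "\<zero>\<^bsub>?B\<^esub> = 0" "mv_one ?B = 1" for x
    by (simp_all add: mv_segment_def mv_one_def)
  have min_mem: "min (x + y) 1 \<in> H" if "x \<in> H" "y \<in> H" for x y
    using that by (simp add: min_def mem_intros)
  have "mv_chain ?B"
  proof
    fix x y assume xy: "x \<in> carrier ?B" "y \<in> carrier ?B"
    then have "mv_le ?B x y" if "x \<le> y"
      using that unfolding mv_le_def carrier by (intro bexI[of _ "y - x"]) (auto simp: plus mem_intros)
    moreover have "mv_le ?B y x" if "y \<le> x"
      using xy that unfolding mv_le_def carrier by (intro bexI[of _ "x - y"]) (auto simp: plus mem_intros)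
    ultimately show "mv_le ?B x y \<or> mv_le ?B y x"
      by linarith
  qed (auto simp: carrier plus ops min_mem mem_intros min_def)
  moreover have "mv_embedding ?B mv_unit_interval id"
    by (auto simp: mv_embedding_def carrier plus ops mv_unit_interval_def)
  ultimately show ?thesis
    unfolding mv_simple_def by blast
qed

text \<open>A sufficiently small \<open>h\<close> is repeated \<open>k\<close> times to give
  \<open>y\<close>. As n * f y stays below f z \<le> 1, the multiples of \<open>y\<close> up to the
  n-th are not truncated and hence strictly increase.\<close>

lemma simple_regular_between:
  assumes "mv_simple B" "mv_dense B" and n: "n > 0"
  shows "mv_regular_between B n"
proof -
  interpret B: mv_chain B
    using assms(1) by (simp add: mv_simple_def)
  obtain f where f: "mv_embedding B mv_unit_interval f"
    using assms(1) by (auto simp: mv_simple_def)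
  have range: "0 \<le> f x" "f x \<le> 1" if "x \<in> carrier B" for x
    using f that by (auto simp: mv_embedding_def mv_unit_interval_def)
  have inj: "f x = f y \<longleftrightarrow> x = y" if "x \<in> carrier B" "y \<in> carrier B" for x y
    using f that by (auto simp: mv_embedding_def inj_on_def)
  have ops: "f \<zero>\<^bsub>B\<^esub> = 0"
    "\<And>x. x \<in> carrier B \<Longrightarrow> f (\<sim>\<^bsub>B\<^esub> x) = 1 - f x"
    "\<And>x y. x \<in> carrier B \<Longrightarrow> y \<in> carrier B \<Longrightarrow> f (x \<oplus>\<^bsub>B\<^esub> y) = min (f x + f y) 1"
    using f by (auto simp: mv_embedding_def mv_unit_interval_def)
  have le: "mv_le B x y \<longleftrightarrow> f x \<le> f y" if xy: "x \<in> carrier B" "y \<in> carrier B" for x y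
  proof -
    have "f x \<le> f y" if "mv_le B x y" "x \<in> carrier B" for x y
      using that range ops(3) unfolding mv_le_def by fastforce
    then show ?thesis
      using xy B.linear[of x y] B.le_refl inj[OF xy] by (metis order_antisym)
  qed
  have less: "mv_less B x y \<longleftrightarrow> f x < f y" if "x \<in> carrier B" "y \<in> carrier B" for x y
    using le[OF that] inj[OF that] by (auto simp: mv_less_def less_le)
  have nmult: "f (mv_nmult B k y) = min (of_nat k * f y) 1" if "y \<in> carrier B" for k y
    using that range[OF that] by (induction k) (auto simp: ops min_def algebra_simps)
  show ?thesis
    unfolding mv_regular_between_def
  proof (intro ballI impI, elim conjE)
    fix x z assume xz: "x \<in> carrier B" "z \<in> carrier B" "x \<noteq> \<zero>\<^bsub>B\<^esub>" "mv_less B x z"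
    then have fx: "0 < f x" "f x < f z"
      using range[OF xz(1)] inj[of x "\<zero>\<^bsub>B\<^esub>"] less by (auto simp: ops)
    obtain r where r: "r \<in> f ` carrier B" "0 < r" "r < (f z - f x) / of_nat n"
    proof (rule small_positive_element[of "f ` carrier B" "f x" "(f z - f x) / of_nat n"])
      show "b - a \<in> f ` carrier B" if ab: "a \<in> f ` carrier B" "b \<in> f ` carrier B" "a < b" for a b
      proof -
        obtain x y where "x \<in> carrier B" "y \<in> carrier B" "a = f x" "b = f y"
          using ab by blast
        then have "b - a = f (y \<ominus>\<^bsub>B\<^esub> x)"
          using ab(3) by (simp add: ops mv_diff_def)
        then show ?thesis
          using \<open>x \<in> carrier B\<close> \<open>y \<in> carrier B\<close> by simp
      qed
      show "\<exists>b\<in>f ` carrier B. 0 < b \<and> b < a" if a: "a \<in> f ` carrier B" "0 < a" for a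
      proof -
        obtain x where x: "x \<in> carrier B" "a = f x"
          using a by blast
        then have "x \<noteq> \<zero>\<^bsub>B\<^esub>"
          using a(2) by (auto simp: ops)
        then obtain y where y: "y \<in> carrier B" "y \<noteq> \<zero>\<^bsub>B\<^esub>" "mv_less B y x"
          using assms(2) x unfolding mv_dense_def by blast
        then have "0 < f y" "f y < f x"
          using range[of y] inj[of y "\<zero>\<^bsub>B\<^esub>"] less x by (auto simp: ops)
        then show ?thesis
          using x y by blast
      qed
    qed (use xz fx n in auto)
    then obtain h where h: "h \<in> carrier B" "0 < f h" "f h < (f z - f x) / of_nat n"
      by blast
    have pos: "0 < of_nat n * f h"
      using h(2) n by simp
    have nh: "of_nat n * f h < f z - f x"
      using h(3) n by (simp add: field_simps)
    define k where "k = nat (\<lfloor>f x / (of_nat n * f h)\<rfloor> + 1)"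
    have "0 \<le> \<lfloor>f x / (of_nat n * f h)\<rfloor>"
      using fx(1) pos by simp
    then have k: "real k = of_int \<lfloor>f x / (of_nat n * f h)\<rfloor> + 1"
      by (simp add: k_def)
    have "f x < of_nat k * (of_nat n * f h)" "of_nat k * (of_nat n * f h) \<le> f x + of_nat n * f h"
      using floor_divide_lower[OF pos, of "f x"] floor_divide_upper[OF pos, of "f x"]
      by (auto simp: k algebra_simps)
    then have lt: "f x < of_nat n * (of_nat k * f h)" "of_nat n * (of_nat k * f h) < f z"
      using nh by (auto simp: mult_ac)
    define y where "y = mv_nmult B k h"
    have y: "y \<in> carrier B"
      using h(1) by (simp add: y_def)
    have "of_nat k * f h \<le> of_nat n * (of_nat k * f h)"
      using mult_right_mono[of 1 "of_nat n" "of_nat k * f h"] n h(2) by simp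
    then have "of_nat k * f h \<le> 1"
      using lt(2) range(2)[OF xz(2)] by linarith
    then have fy: "f y = of_nat k * f h"
      using nmult[OF h(1)] by (simp add: y_def)
    have fy0: "0 < f y"
    proof -
      have "0 < of_nat n * f y"
        using lt(1) fx(1) fy by simp
      then show ?thesis
        using n by (simp add: zero_less_mult_iff)
    qed
    have fny: "f (mv_nmult B j y) = of_nat j * f y" if "j \<le> n" for j
    proof -
      have "of_nat j * f y \<le> of_nat n * f y"
        using that fy0 by simp
      then show ?thesis
        using nmult[OF y] lt(2) fy range(2)[OF xz(2)] by simp
    qed
    show "\<exists>y\<in>carrier B. mv_le B x (mv_nmult B n y) \<and> mv_le B (mv_nmult B n y) z \<and>
        (\<forall>k<n. mv_less B (mv_nmult B k y) (mv_nmult B (Suc k) y))"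
    proof (intro bexI[of _ y] conjI allI impI)
      show "mv_le B x (mv_nmult B n y)" "mv_le B (mv_nmult B n y) z"
        using lt fy fny[of n] y xz by (auto simp: le)
      fix j assume "j < n"
      then show "mv_less B (mv_nmult B j y) (mv_nmult B (Suc j) y)"
        using less[of "mv_nmult B j y" "mv_nmult B (Suc j) y"] fny[of j] fny[of "Suc j"] y fy0
        by (auto simp del: mv_nmult.simps simp: algebra_simps)
    qed (rule y)
  qed
qed

section \<open>A countable elementary substructure\<close>

instance mv_term :: countable
  by countable_datatype

instance mv_form :: countable
  by countable_datatype

text \<open>Closed Skolem terms: a formula, the quantified variable, and argument terms. As a
  datatype over countable types they are countable, and their values form the hull at once, without
  iterated closure.\<close>

datatype skolem = Witness mv_form nat "skolem list"

instance skolem :: countable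
  by countable_datatype

definition list_env :: "('a, 'b) mv_struct_scheme \<Rightarrow> 'a list \<Rightarrow> nat \<Rightarrow> 'a"
  where "list_env A xs j = (if j < length xs then xs ! j else \<zero>\<^bsub>A\<^esub>)"

text \<open>\<open>All\<close> is the primitive quantifier, so the Skolem functions choose
  counterexamples. The default \<open>\<zero>\<close> keeps the value in the carrier.\<close>

definition counterexample :: "('a, 'b) mv_struct_scheme \<Rightarrow> mv_form \<Rightarrow> nat \<Rightarrow> (nat \<Rightarrow> 'a) \<Rightarrow> 'a"
  where "counterexample A p i e =
    (if \<exists>a\<in>carrier A. \<not> sat A (e(i := a)) p then SOME a. a \<in> carrier A \<and> \<not> sat A (e(i := a)) p
     else \<zero>\<^bsub>A\<^esub>)"

primrec skolem_val :: "('a, 'b) mv_struct_scheme \<Rightarrow> skolem \<Rightarrow> 'a"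
  where "skolem_val A (Witness p i ts) = counterexample A p i (list_env A (map (skolem_val A) ts))"

definition skolem_hull :: "('a, 'b) mv_struct_scheme \<Rightarrow> ('a, 'b) mv_struct_scheme"
  where "skolem_hull A = A\<lparr>carrier := range (skolem_val A)\<rparr>"

lemma skolem_hull_simps [simp]:
  "carrier (skolem_hull A) = range (skolem_val A)" "\<zero>\<^bsub>skolem_hull A\<^esub> = \<zero>\<^bsub>A\<^esub>"
  "\<sim>\<^bsub>skolem_hull A\<^esub> x = \<sim>\<^bsub>A\<^esub> x" "x \<oplus>\<^bsub>skolem_hull A\<^esub> y = x \<oplus>\<^bsub>A\<^esub> y"
  "mv_one (skolem_hull A) = mv_one A"
  by (simp_all add: skolem_hull_def mv_one_def)

lemma term_val_cong: "(\<And>j. j \<in> term_vars t \<Longrightarrow> d j = e j) \<Longrightarrow> term_val A d t = term_val A e t"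
  by (induction t) auto

lemma free_vars_subset: "free_vars p \<subseteq> form_vars p"
  by (induction p) auto

lemma sat_cong: "(\<And>j. j \<in> free_vars p \<Longrightarrow> d j = e j) \<Longrightarrow> sat A d p \<longleftrightarrow> sat A e p"
proof (induction p arbitrary: d e)
  case (Eq s t)
  then have "term_val A d s = term_val A e s" "term_val A d t = term_val A e t"
    by (auto intro!: term_val_cong)
  then show ?case by simp
next
  case (Imp p q)
  have "sat A d p \<longleftrightarrow> sat A e p" "sat A d q \<longleftrightarrow> sat A e q"
    by (rule Imp.IH; use Imp.prems in simp)+
  then show ?case by simp
next
  case (All i p)
  have "sat A (d(i := a)) p \<longleftrightarrow> sat A (e(i := a)) p" for a
    by (rule All.IH) (use All.prems in auto)
  then show ?case by simp
qed simp

context mv_algebra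
begin

lemma counterexample:
  assumes "a \<in> carrier A" "\<not> sat A (e(i := a)) p"
  shows "counterexample A p i e \<in> carrier A" "\<not> sat A (e(i := counterexample A p i e)) p"
proof -
  have "counterexample A p i e \<in> carrier A \<and> \<not> sat A (e(i := counterexample A p i e)) p"
    using assms someI_ex[of "\<lambda>a. a \<in> carrier A \<and> \<not> sat A (e(i := a)) p"]
    unfolding counterexample_def by auto
  then show "counterexample A p i e \<in> carrier A" "\<not> sat A (e(i := counterexample A p i e)) p"
    by auto
qed

lemma counterexample_closed: "counterexample A p i e \<in> carrier A"
proof (cases "\<exists>a\<in>carrier A. \<not> sat A (e(i := a)) p")
  case True
  then show ?thesis
    using counterexample(1) by blast
qed (simp add: counterexample_def)

lemma skolem_val_closed: "skolem_val A t \<in> carrier A"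
  by (cases t) (simp add: counterexample_closed)

text \<open>This is the Tarski-Vaught test. Only the values at the finitely many free variables
  matter, so a list of Skolem terms encodes the environment.\<close>

lemma counterexample_mem_skolem_hull:
  assumes "range e \<subseteq> range (skolem_val A)" "a \<in> carrier A" "\<not> sat A (e(i := a)) p"
  obtains w where "w \<in> range (skolem_val A)" "\<not> sat A (e(i := w)) p"
proof -
  obtain n where n: "free_vars p \<subseteq> {..<n}"
    using finite_subset[OF free_vars_subset finite_form_vars] unfolding finite_nat_set_iff_bounded by blast
  have "\<exists>t. e j = skolem_val A t" for j
    using subsetD[OF assms(1), of "e j"] by blast
  then obtain t where t: "\<And>j. e j = skolem_val A (t j)"
    by metis
  define w where "w = skolem_val A (Witness p i (map t [0..<n]))"
  define d where "d = list_env A (map (skolem_val A) (map t [0..<n]))"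
  have eq: "sat A (d(i := x)) p \<longleftrightarrow> sat A (e(i := x)) p" for x
    by (rule sat_cong) (use n t in \<open>auto simp: d_def list_env_def\<close>)
  have "w = counterexample A p i d"
    by (simp add: w_def d_def)
  then have "\<not> sat A (e(i := w)) p"
    using counterexample(2)[of a d i p] assms(2,3) eq by simp
  moreover have "w \<in> range (skolem_val A)"
    unfolding w_def by (rule rangeI)
  ultimately show thesis
    using that by blast
qed

text \<open>The formula saying that variable 2 differs from \<open>t\<close> has the value of
  \<open>t\<close> as its only counterexample, so the Tarski-Vaught test puts that value into the
  hull.\<close>

lemma skolem_hull_closed:
  assumes x: "x \<in> range (skolem_val A)" and y: "y \<in> range (skolem_val A)"
  shows "\<zero> \<in> range (skolem_val A)" "\<sim> x \<in> range (skolem_val A)" "x \<oplus> y \<in> range (skolem_val A)"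
proof -
  have xy: "x \<in> carrier A" "y \<in> carrier A"
    using x y skolem_val_closed by auto
  have *: "a \<in> range (skolem_val A)"
    if t: "a \<in> carrier A" "term_val A (\<lambda>j. if j = 0 then x else y) t = a" "term_vars t \<subseteq> {0, 1}" for a t
  proof -
    let ?e = "\<lambda>j::nat. if j = 0 then x else y" and ?p = "Imp (Eq (Var 2) t) Falsum"
    have val: "term_val A (?e(2 := b)) t = a" for b
    proof -
      have "term_val A (?e(2 := b)) t = term_val A ?e t"
        by (rule term_val_cong) (use t(3) in auto)
      then show ?thesis
        using t(2) by simp
    qed
    obtain w where "w \<in> range (skolem_val A)" "\<not> sat A (?e(2 := w)) ?p"
      by (rule counterexample_mem_skolem_hull[of ?e a 2 ?p]) (use x y t(1) val in auto)
    then show ?thesis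
      using val by auto
  qed
  show "\<zero> \<in> range (skolem_val A)"
    by (rule *[of _ Zero]) auto
  show "\<sim> x \<in> range (skolem_val A)"
    by (rule *[of _ "Neg (Var 0)"]) (use xy in auto)
  show "x \<oplus> y \<in> range (skolem_val A)"
    by (rule *[of _ "Plus (Var 0) (Var 1)"]) (use xy in auto)
qed

lemma skolem_hull_carrier_subset: "range (skolem_val A) \<subseteq> carrier A"
  using skolem_val_closed by blast

lemma term_val_skolem_hull: "term_val (skolem_hull A) e t = term_val A e t"
  by (induction t) auto

lemma sat_skolem_hull:
  "range e \<subseteq> range (skolem_val A) \<Longrightarrow> sat (skolem_hull A) e p \<longleftrightarrow> sat A e p"
proof (induction p arbitrary: e)
  case (All i p)
  have upd: "sat (skolem_hull A) (e(i := a)) p \<longleftrightarrow> sat A (e(i := a)) p"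
    if "a \<in> range (skolem_val A)" for a
    by (rule All.IH) (use All.prems that in auto)
  show ?case
  proof
    assume *: "sat (skolem_hull A) e (All i p)"
    show "sat A e (All i p)"
    proof (rule ccontr)
      assume "\<not> sat A e (All i p)"
      then obtain a where a: "a \<in> carrier A" "\<not> sat A (e(i := a)) p"
        by auto
      obtain w where w: "w \<in> range (skolem_val A)" "\<not> sat A (e(i := w)) p"
        by (rule counterexample_mem_skolem_hull[OF All.prems a])
      moreover have "sat (skolem_hull A) (e(i := w)) p"
        using * w(1) unfolding sat.simps skolem_hull_simps by (rule bspec)
      ultimately show False
        by (simp add: upd[OF w(1)])
    qed
  next
    assume *: "sat A e (All i p)"
    show "sat (skolem_hull A) e (All i p)"
      unfolding sat.simps skolem_hull_simps
    proof
      fix a assume a: "a \<in> range (skolem_val A)"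
      then have "a \<in> carrier A"
        using skolem_hull_carrier_subset by blast
      then have "sat A (e(i := a)) p"
        using * by simp
      then show "sat (skolem_hull A) (e(i := a)) p"
        by (simp add: upd[OF a])
    qed
  qed
qed (auto simp: term_val_skolem_hull)

end

text \<open>The equational axioms are inherited. Linearity hides an existential in
  \<open>mv_le\<close>, but its witness \<open>y \<ominus> x\<close> is given by a term and stays in
  the hull.\<close>

lemma (in mv_chain) mv_chain_skolem_hull: "mv_chain (skolem_hull A)"
proof -
  note closed = skolem_hull_closed
  have carrier: "x \<in> carrier A" if "x \<in> range (skolem_val A)" for x
    using that skolem_hull_carrier_subset by blast
  show ?thesis
  proof (unfold_locales, unfold skolem_hull_simps)
    fix x y assume xy: "x \<in> range (skolem_val A)" "y \<in> range (skolem_val A)"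
    have "mv_le (skolem_hull A) x y" if "mv_le A x y" "x \<in> range (skolem_val A)" "y \<in> range (skolem_val A)" for x y
    proof -
      have "x \<oplus> (y \<ominus> x) = y"
        by (rule plus_diff[OF that(1) carrier[OF that(2)] carrier[OF that(3)]])
      moreover have "y \<ominus> x \<in> range (skolem_val A)"
        unfolding mv_diff_def
        by (rule closed(2)[OF closed(3)[OF closed(2)[OF that(3,3)] that(2)] that(2)])
      ultimately show ?thesis
        unfolding mv_le_def by auto
    qed
    from this[OF _ xy] this[OF _ xy(2,1)]
    show "mv_le (skolem_hull A) x y \<or> mv_le (skolem_hull A) y x"
      using linear[OF carrier[OF xy(1)] carrier[OF xy(2)]] by blast
  qed (use closed closed(1)[OF rangeI rangeI] carrier in \<open>auto simp: plus_assoc intro: plus_comm lukasiewicz\<close>)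
qed

section \<open>Density and regularity as sentences\<close>

abbreviation Not_form :: "mv_form \<Rightarrow> mv_form"
  where "Not_form p \<equiv> Imp p Falsum"

abbreviation Conj_form :: "mv_form \<Rightarrow> mv_form \<Rightarrow> mv_form"
  where "Conj_form p q \<equiv> Not_form (Imp p (Not_form q))"

abbreviation Ex_form :: "nat \<Rightarrow> mv_form \<Rightarrow> mv_form"
  where "Ex_form i p \<equiv> Not_form (All i (Not_form p))"

definition Le_form :: "mv_term \<Rightarrow> mv_term \<Rightarrow> mv_form"
  where "Le_form s t = Eq (Plus (Neg s) t) (Neg Zero)"

abbreviation Less_form :: "mv_term \<Rightarrow> mv_term \<Rightarrow> mv_form"
  where "Less_form s t \<equiv> Conj_form (Le_form s t) (Not_form (Eq s t))"

text \<open>Variable 2 is the element to be multiplied; 0 and 1 are reserved for the ends of the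
  interval.\<close>

primrec nmult_term :: "nat \<Rightarrow> mv_term"
  where
    "nmult_term 0 = Zero"
  | "nmult_term (Suc n) = Plus (nmult_term n) (Var 2)"

primrec chain_form :: "nat \<Rightarrow> mv_form"
  where
    "chain_form 0 = Not_form Falsum"
  | "chain_form (Suc n) = Conj_form (chain_form n) (Less_form (nmult_term n) (nmult_term (Suc n)))"

definition dense_form :: mv_form
  where "dense_form = All 0 (Imp (Not_form (Eq (Var 0) Zero))
    (Ex_form 1 (Conj_form (Not_form (Eq (Var 1) Zero)) (Less_form (Var 1) (Var 0)))))"

definition regular_form :: "nat \<Rightarrow> mv_form"
  where "regular_form n = All 0 (All 1 (Imp
    (Conj_form (Not_form (Eq (Var 0) Zero)) (Less_form (Var 0) (Var 1)))
    (Ex_form 2 (Conj_form (Le_form (Var 0) (nmult_term n))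
      (Conj_form (Le_form (nmult_term n) (Var 1)) (chain_form n))))))"

lemma free_vars_Le_form [simp]: "free_vars (Le_form s t) = term_vars s \<union> term_vars t"
  by (simp add: Le_form_def)

lemma term_vars_nmult_term: "term_vars (nmult_term n) \<subseteq> {2}"
  by (induction n) auto

lemma free_vars_chain_form: "free_vars (chain_form n) \<subseteq> {2}"
  by (induction n) (use term_vars_nmult_term in auto)

lemma sentence_dense_form: "mv_sentence dense_form"
  by (auto simp: mv_sentence_def dense_form_def)

lemma sentence_regular_form: "mv_sentence (regular_form n)"
  using term_vars_nmult_term free_vars_chain_form by (auto simp: mv_sentence_def regular_form_def)

context mv_algebra
begin

lemma sat_Le_form [simp]:
  "term_val A e s \<in> carrier A \<Longrightarrow> term_val A e t \<in> carrier A \<Longrightarrow>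
    sat A e (Le_form s t) \<longleftrightarrow> mv_le A (term_val A e s) (term_val A e t)"
  by (simp add: Le_form_def le_iff)

lemma term_val_nmult_term [simp]: "term_val A e (nmult_term n) = mv_nmult A n (e 2)"
  by (induction n) auto

lemma sat_chain_form [simp]:
  "e 2 \<in> carrier A \<Longrightarrow> sat A e (chain_form n) \<longleftrightarrow>
    (\<forall>k<n. mv_less A (mv_nmult A k (e 2)) (mv_nmult A (Suc k) (e 2)))"
  by (induction n) (auto simp: less_Suc_eq mv_less_def)

lemma sat_dense_form: "sat A e dense_form \<longleftrightarrow> mv_dense A"
  by (auto simp: dense_form_def mv_dense_def mv_less_def)

lemma sat_regular_form: "sat A e (regular_form n) \<longleftrightarrow> mv_regular_between A n"
  by (simp add: regular_form_def mv_regular_between_def mv_less_def Bex_def conj_ac cong: conj_cong)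

end

lemma sat_sentence: "mv_sentence p \<Longrightarrow> sat A d p \<longleftrightarrow> sat A e p"
  by (rule sat_cong) (simp add: mv_sentence_def)

text \<open>Simple chains may have atoms, so the sentence true in all of them is the implication
  from density to regularity at \<open>n\<close>.\<close>

lemma pseudo_simple_imp_regular_between:
  fixes A :: "('a, 'b) mv_struct_scheme"
  assumes "mv_chain A" "mv_dense A" "pseudo_simple A" "n > 0"
  shows "mv_regular_between A n"
proof -
  interpret mv_chain A by (fact assms(1))
  have env: "range (\<lambda>_::nat. \<zero>\<^bsub>A\<^esub>) \<subseteq> carrier A"
    by auto
  have "mv_models A (Imp dense_form (regular_form n))"
  proof -
    have "mv_models B (Imp dense_form (regular_form n))" if "mv_simple B" for B :: "real mv_struct"
    proof -
      have "mv_algebra B"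
        using that by (simp add: mv_simple_def mv_chain_def)
      then show ?thesis
        using simple_regular_between[OF that] assms(4)
        by (simp add: mv_models_def mv_algebra.sat_dense_form mv_algebra.sat_regular_form)
    qed
    moreover have "mv_sentence (Imp dense_form (regular_form n))"
      using sentence_dense_form sentence_regular_form by (simp add: mv_sentence_def)
    ultimately show ?thesis
      using assms(3) unfolding pseudo_simple_def by blast
  qed
  then have "sat A (\<lambda>_. \<zero>\<^bsub>A\<^esub>) (Imp dense_form (regular_form n))"
    using env unfolding mv_models_def by blast
  then show ?thesis
    using sat_dense_form sat_regular_form assms(2) by simp
qed

lemma regular_imp_pseudo_simple:
  fixes A :: "('a, 'b) mv_struct_scheme"
  assumes "mv_chain A" "\<zero>\<^bsub>A\<^esub> \<noteq> mv_one A" "mv_dense A" and regular: "\<And>n. n \<ge> 2 \<Longrightarrow> mv_regular_between A n"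
  shows "pseudo_simple A"
proof -
  interpret mv_chain A by (fact assms(1))
  let ?B = "skolem_hull A"
  interpret B: mv_chain ?B by (rule mv_chain_skolem_hull)
  \<comment> \<open>Sentences are compared at the constant zero environment, which \<phi> preserves;
    their truth does not depend on the environment.\<close>
  have env: "range (\<lambda>_::nat. \<zero>\<^bsub>A\<^esub>) \<subseteq> carrier A" "range (\<lambda>_::nat. \<zero>\<^bsub>A\<^esub>) \<subseteq> range (skolem_val A)"
    "range (\<lambda>_::nat. \<zero>\<^bsub>A\<^esub>) \<subseteq> carrier ?B"
    using B.zero_closed by auto
  note elem = sat_skolem_hull[OF env(2)]
  have "mv_dense ?B"
    using elem[of dense_form] sat_dense_form B.sat_dense_form assms(3) by simp
  moreover have "mv_regular_between ?B n" if "n \<ge> 2" for n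
    using elem[of "regular_form n"] sat_regular_form B.sat_regular_form regular[OF that] by simp
  moreover obtain \<phi> where "chain_real_map ?B \<phi>"
    using B.obtain_chain_real_map assms(2) by auto
  ultimately interpret R: regular_chain_real_map ?B \<phi>
    by (intro regular_chain_real_map.intro regular_chain_real_map_axioms.intro)
  interpret Q: regular_cone R.H R.P by (rule R.regular_cone)
  interpret two_regular_cones R.H R.P "R.H \<inter> {0<..}"
    using R.regular_cone Q.regular_cone_usual by (rule two_regular_cones.intro)
  show ?thesis
    unfolding pseudo_simple_def
  proof (intro allI impI, elim conjE)
    fix p assume p: "mv_sentence p" "\<forall>B :: real mv_struct. mv_simple B \<longrightarrow> mv_models B p"
    have "mv_models (mv_segment R.H (R.H \<inter> {0<..})) p"
      using p(2) R.simple_segment_usual by blast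
    moreover have "range (\<lambda>_::nat. 0) \<subseteq> carrier (mv_segment R.H (R.H \<inter> {0<..}))"
      using R.zero_mem by (auto simp: mv_segment_def)
    ultimately have "sat (mv_segment R.H (R.H \<inter> {0<..})) (\<lambda>_. 0) p"
      unfolding mv_models_def by blast
    then have "sat (mv_segment R.H R.P) (\<lambda>_. 0) p"
      by (simp add: sat_zero_env_iff)
    moreover have "\<phi> \<circ> (\<lambda>_::nat. \<zero>\<^bsub>A\<^esub>) = (\<lambda>_. 0)"
      using R.map_zero by (simp add: fun_eq_iff)
    ultimately have "sat ?B (\<lambda>_. \<zero>\<^bsub>A\<^esub>) p"
      using sat_embedding_onto[OF B.mv_algebra_axioms R.embedding R.image_carrier env(3), of p] by simp
    then have "sat A (\<lambda>_. \<zero>\<^bsub>A\<^esub>) p"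
      using elem by simp
    then show "mv_models A p"
      unfolding mv_models_def using sat_sentence[OF p(1)] by blast
  qed
qed

text \<open>Nontriviality excludes the one-element algebra: it is atomless and vacuously regular,
  but it violates the sentence that zero and one differ, which holds in every simple chain.\<close>

theorem theorem5p11:
  fixes A :: "('a, 'b) mv_struct_scheme" (structure)
  assumes "mv_chain A"
    and "\<zero> \<noteq> \<one>"
    and "mv_atomless A"
  shows "pseudo_simple A \<longleftrightarrow> mv_regular A"
proof -
  interpret mv_chain A by (fact assms(1))
  have "mv_dense A"
    using assms(3) by (simp add: atomless_iff_dense)
  then show ?thesis
    using pseudo_simple_imp_regular_between[OF assms(1)] regular_imp_pseudo_simple[OF assms(1,2)]
      regular_iff_between by fastforce
qed

end
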